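(* Let $G$ be a non-trivial finite reflection group. Then $\varUpsilon_2(G)\neq\{1_G\}$ if and only if $G$ is a dihedral group of order $2n$ with $n$ odd. In this case, $\varUpsilon_2(G)$ consists of the two linear characters of $G$.
   Context: A finite reflection group is a finite group generated by reflections of a real Euclidean space (equivalently, a finite Coxeter group). The dihedral group of order $2n$ is considered for all $n\geq 1$; for $n=1$ it is the cyclic group of order $2$. For a finite group $G$ and a prime $p$ dividing $|G|$, $\varSigma_p(G)$ is the set of $p$-singular elements of $G$, i.e. the elements whose order is divisible by $p$. A complex irreducible character $\chi$ of $G$ is $p$-constant if there is a constant $c_\chi$ with $\chi(g)=c_\chi$ for all $g\in\varSigma_p(G)$. $\varUpsilon_p(G)$ denotes the set of irreducible $p$-constant characters of $G$ of non-zero $p$-defect, equivalently the irreducible $p$-constant characters with $c_\chi\neq 0$. $1_G$ is the principal character. *)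

theory Defs
  imports
    "HOL-Analysis.Linear_Algebra"
    "HOL-Algebra.Multiplicative_Group"
    "HOL-Algebra.Generated_Groups"
    "HOL-Computational_Algebra.Primes"
    "Jordan_Normal_Form.VS_Connect"
begin

section \<open>Finite reflection groups\<close>

definition orthogonal_group :: "('a::euclidean_space \<Rightarrow> 'a) monoid" where
  "orthogonal_group =
     \<lparr>carrier = {f. orthogonal_transformation f}, monoid.mult = (\<circ>), one = id\<rparr>"

definition reflection :: "'a::euclidean_space \<Rightarrow> 'a \<Rightarrow> 'a" where
  "reflection v x = x - (2 * inner x v / inner v v) *\<^sub>R v"

text \<open>Reflections are taken in the nonzero vectors; \<open>reflection 0\<close> is the identity.\<close>

definition finite_reflection_group :: "('a::euclidean_space \<Rightarrow> 'a) monoid \<Rightarrow> bool" where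
  "finite_reflection_group G \<longleftrightarrow> finite (carrier G) \<and>
     (\<exists>V. 0 \<notin> V \<and> G = subgroup_generated orthogonal_group (reflection ` V))"


section \<open>Dihedral groups\<close>

text \<open>The pair \<open>(a, s)\<close> stands for \<open>r\<^sup>a f\<^sup>s\<close>, where \<open>r\<close> has order \<open>n\<close>, \<open>f\<close> has order \<open>2\<close> and
  \<open>f r f\<close> is the inverse of \<open>r\<close>. The group has order \<open>2n\<close> for every \<open>n \<ge> 1\<close>; it is cyclic of
  order \<open>2\<close> for \<open>n = 1\<close> and the Klein four-group for \<open>n = 2\<close>. The value at \<open>n = 0\<close> is junk (empty
  carrier).\<close>

definition dihedral_group :: "nat \<Rightarrow> (int \<times> bool) monoid" where
  "dihedral_group n =
     \<lparr>carrier = {0..<int n} \<times> UNIV,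
      monoid.mult = (\<lambda>(a, s) (b, t). ((if s then a - b else a + b) mod int n, s \<noteq> t)),
      one = (0, False)\<rparr>"


section \<open>Complex irreducible characters\<close>

definition GL :: "nat \<Rightarrow> complex mat monoid" where
  "GL n = units_of (ring_mat TYPE(complex) n ())"

definition invariant_subspace ::
    "('g, 'm) monoid_scheme \<Rightarrow> nat \<Rightarrow> ('g \<Rightarrow> complex mat) \<Rightarrow> complex vec set \<Rightarrow> bool" where
  "invariant_subspace G n \<rho> W \<longleftrightarrow>
     VectorSpace.subspace class_ring W (module_vec TYPE(complex) n) \<and>
     (\<forall>g\<in>carrier G. \<forall>w\<in>W. \<rho> g *\<^sub>v w \<in> W)"

definition irreducible_representation ::
    "('g, 'm) monoid_scheme \<Rightarrow> nat \<Rightarrow> ('g \<Rightarrow> complex mat) \<Rightarrow> bool" where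
  "irreducible_representation G n \<rho> \<longleftrightarrow> \<rho> \<in> hom G (GL n) \<and> n > 0 \<and>
     (\<forall>W. invariant_subspace G n \<rho> W \<longrightarrow> W = {0\<^sub>v n} \<or> W = carrier_vec n)"

text \<open>Characters are made \<open>undefined\<close> outside the carrier, so that equality of characters is
  equality of functions on the group.\<close>

definition rep_character ::
    "('g, 'm) monoid_scheme \<Rightarrow> nat \<Rightarrow> ('g \<Rightarrow> complex mat) \<Rightarrow> 'g \<Rightarrow> complex" where
  "rep_character G n \<rho> = (\<lambda>g\<in>carrier G. \<Sum>i<n. \<rho> g $$ (i, i))"

definition irreducible_characters :: "('g, 'm) monoid_scheme \<Rightarrow> ('g \<Rightarrow> complex) set" where
  "irreducible_characters G =
     {rep_character G n \<rho> | n \<rho>. irreducible_representation G n \<rho>}"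

definition principal_character :: "('g, 'm) monoid_scheme \<Rightarrow> 'g \<Rightarrow> complex" where
  "principal_character G = (\<lambda>g\<in>carrier G. 1)"

definition character_degree :: "('g, 'm) monoid_scheme \<Rightarrow> ('g \<Rightarrow> complex) \<Rightarrow> nat" where
  "character_degree G \<chi> = (THE d. \<chi> \<one>\<^bsub>G\<^esub> = of_nat d)"

definition linear_characters :: "('g, 'm) monoid_scheme \<Rightarrow> ('g \<Rightarrow> complex) set" where
  "linear_characters G = {\<chi> \<in> irreducible_characters G. character_degree G \<chi> = 1}"


section \<open>$p$-constant characters\<close>

definition p_singular_elements :: "nat \<Rightarrow> ('g, 'm) monoid_scheme \<Rightarrow> 'g set" where
  "p_singular_elements p G = {g \<in> carrier G. p dvd group.ord G g}"

definition p_constant :: "nat \<Rightarrow> ('g, 'm) monoid_scheme \<Rightarrow> ('g \<Rightarrow> complex) \<Rightarrow> bool" where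
  "p_constant p G \<chi> \<longleftrightarrow> (\<exists>c. \<forall>g\<in>p_singular_elements p G. \<chi> g = c)"

text \<open>The \<open>p\<close>-defect of \<open>\<chi>\<close> is the exponent of \<open>p\<close> in \<open>|G| / \<chi>(1)\<close>.\<close>

definition p_defect :: "nat \<Rightarrow> ('g, 'm) monoid_scheme \<Rightarrow> ('g \<Rightarrow> complex) \<Rightarrow> int" where
  "p_defect p G \<chi> =
     int (multiplicity p (Coset.order G)) - int (multiplicity p (character_degree G \<chi>))"

definition Upsilon :: "nat \<Rightarrow> ('g, 'm) monoid_scheme \<Rightarrow> ('g \<Rightarrow> complex) set" where
  "Upsilon p G = {\<chi> \<in> irreducible_characters G. p_constant p G \<chi> \<and> p_defect p G \<chi> \<noteq> 0}"

end

theory Submission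
  imports
    Defs
    "HOL-Algebra.Sylow"
    "Jordan_Normal_Form.Spectral_Radius"
begin

text \<open>The determinant is a homomorphism \<open>\<epsilon>\<close> from a nontrivial reflection group onto \<open>{1, -1}\<close>. For any
  finite group with such a homomorphism, an irreducible character \<open>\<chi>\<close> other than \<open>1\<close> and \<open>\<epsilon>\<close> satisfies
  \<open>\<Sum>g. (1 - \<epsilon> g) \<chi> g = 0\<close>. If \<open>\<chi>\<close> has the constant value \<open>c\<close> on the \<open>2\<close>-singular elements, this sum
  equals \<open>2 c\<close> times the number of elements of sign \<open>-1\<close>, because elements of odd order have sign \<open>1\<close>.
  So \<open>c = 0\<close>, and \<open>\<chi>\<close> has defect zero: its degree is divisible by the order of a Sylow \<open>2\<close>-subgroup
  and divides the order of the group. Therefore \<open>Upsilon 2 G\<close> lies between \<open>{1}\<close> and \<open>{1, \<epsilon>}\<close>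
  (lemmas \<open>principal_in_Upsilon\<close> and \<open>Upsilon_subset\<close>), and it contains \<open>\<epsilon>\<close> if and only if all
  elements of sign \<open>1\<close> have odd order.

  In a dihedral group of order \<open>2 n\<close> with \<open>n\<close> odd this condition holds, and \<open>1\<close> and \<open>\<epsilon>\<close> are the only
  linear characters (\<open>odd_dihedral_Upsilon\<close>).

  Conversely, let \<open>G\<close> be a reflection group whose elements of determinant \<open>1\<close> all have odd order.
  Two involutions have determinant \<open>-1\<close>, so their product has odd order and they are conjugate.
  Hence all involutions are reflections. An element of determinant \<open>-1\<close> is in a unique way the
  product of an involution \<open>z\<close> and of a rotation that commutes with \<open>z\<close>; such a rotation fixes the
  root of \<open>z\<close>. On the span of the roots, if its dimension is at least two, the sum of all elements of
  determinant \<open>-1\<close> vanishes, since neither the trivial representation nor the determinant occurs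
  there. If this dimension were three, the rotations that commute with a reflection \<open>z\<close> would be
  either trivial or rotations about the root of \<open>z\<close>, for all \<open>z\<close> at the same time. In the first case
  the sum has trace equal to the number of involutions, and in the second case it is negative
  definite on the span of the roots; both are impossible (\<open>dim_roots_neq_3\<close>). When applied to the
  subgroups generated by three reflections, this shows that all roots lie in a plane
  (\<open>roots_coplanar\<close>). The elements of determinant \<open>1\<close> then form a finite group of plane rotations.
  It is isomorphic to the group of \<open>n\<close>-th roots of unity for an odd \<open>n\<close>, and it is inverted by every
  reflection, so that \<open>G\<close> is dihedral (\<open>iso_dihedral\<close>).\<close>

section \<open>Matrix representations and Schur's lemma\<close>

lemma invariant_subspaceI:
  assumes "W \<subseteq> carrier_vec n" and "0\<^sub>v n \<in> W"
    and "\<And>v w. v \<in> W \<Longrightarrow> w \<in> W \<Longrightarrow> v + w \<in> W"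
    and "\<And>c v. v \<in> W \<Longrightarrow> c \<cdot>\<^sub>v v \<in> W"
    and "\<And>g v. g \<in> carrier G \<Longrightarrow> v \<in> W \<Longrightarrow> \<rho> g *\<^sub>v v \<in> W"
  shows "invariant_subspace G n \<rho> W"
proof -
  have "submodule class_ring W (module_vec TYPE(complex) n)"
    by (rule submodule.intro) (use assms vec_module in \<open>auto simp: module_vec_simps\<close>)
  then have "VectorSpace.subspace class_ring W (module_vec TYPE(complex) n)"
    by (intro VectorSpace.subspace.intro vec_vs)
  with assms(5) show ?thesis by (auto simp: invariant_subspace_def)
qed

lemma GL_carrier:
  assumes "A \<in> carrier (GL n)" shows "A \<in> carrier_mat n n"
  using assms by (auto simp: GL_def units_of_def Units_def ring_mat_simps)

lemma group_GL: "group (GL n)"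
  unfolding GL_def by (intro monoid.units_group ring.is_monoid ring_mat)

lemma GL_mult [simp]: "A \<otimes>\<^bsub>GL n\<^esub> B = A * B" and GL_one [simp]: "\<one>\<^bsub>GL n\<^esub> = 1\<^sub>m n"
  by (auto simp: GL_def units_of_def ring_mat_simps)

locale matrix_rep = group G for G :: "('g, 'm) monoid_scheme" (structure) +
  fixes n :: nat and \<rho> :: "'g \<Rightarrow> complex mat"
  assumes finite_carrier: "finite (carrier G)" and hom: "\<rho> \<in> hom G (GL n)"
begin

lemma rep_carrier: "g \<in> carrier G \<Longrightarrow> \<rho> g \<in> carrier_mat n n"
  using hom by (auto simp: hom_def intro!: GL_carrier)

lemma rep_mult: "g \<in> carrier G \<Longrightarrow> h \<in> carrier G \<Longrightarrow> \<rho> (g \<otimes> h) = \<rho> g * \<rho> h"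
  using hom by (auto simp: hom_def)

lemma rep_one: "\<rho> \<one> = 1\<^sub>m n"
  using hom_one[OF hom is_group group_GL] by simp

lemma entry_mult:
  assumes "g \<in> carrier G" "h \<in> carrier G" "i < n" "j < n"
  shows "\<rho> (g \<otimes> h) $$ (i, j) = (\<Sum>k<n. \<rho> g $$ (i, k) * \<rho> h $$ (k, j))"
  using assms rep_carrier[of g] rep_carrier[of h]
  by (auto simp: rep_mult scalar_prod_def atLeast0LessThan)

lemma entry_one: "i < n \<Longrightarrow> j < n \<Longrightarrow> \<rho> \<one> $$ (i, j) = (if i = j then 1 else 0)"
  by (simp add: rep_one)

lemma character_one: "rep_character G n \<rho> \<one> = of_nat n"
  by (simp add: rep_character_def entry_one)

lemma character_degree: "character_degree G (rep_character G n \<rho>) = n"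
  unfolding character_degree_def character_one by auto

end

locale irreducible_rep = matrix_rep +
  assumes irreducible: "irreducible_representation G n \<rho>"
begin

lemma degree_pos: "n > 0" using irreducible by (simp add: irreducible_representation_def)

lemma invariant_subspace_trivial:
  "invariant_subspace G n \<rho> W \<Longrightarrow> w \<in> W \<Longrightarrow> w \<noteq> 0\<^sub>v n \<Longrightarrow> W = carrier_vec n"
  using irreducible by (auto simp: irreducible_representation_def)

text \<open>Schur's lemma: the eigenspace of an intertwining matrix is invariant.\<close>

lemma schur:
  assumes M: "M \<in> carrier_mat n n"
    and comm: "\<And>g. g \<in> carrier G \<Longrightarrow> \<rho> g * M = M * \<rho> g"
  obtains \<mu> where "M = \<mu> \<cdot>\<^sub>m 1\<^sub>m n"
proof -
  obtain \<mu> where "eigenvalue M \<mu>"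
    using spectrum_non_empty[OF M degree_pos] by (auto simp: spectrum_def)
  then obtain v where v: "v \<in> carrier_vec n" "v \<noteq> 0\<^sub>v n" "M *\<^sub>v v = \<mu> \<cdot>\<^sub>v v"
    using M by (auto simp: eigenvalue_def eigenvector_def)
  define W where "W = {w \<in> carrier_vec n. M *\<^sub>v w = \<mu> \<cdot>\<^sub>v w}"
  have "invariant_subspace G n \<rho> W"
  proof (rule invariant_subspaceI)
    fix g w assume g: "g \<in> carrier G" and w: "w \<in> W"
    note \<rho> = rep_carrier[OF g]
    have "M *\<^sub>v (\<rho> g *\<^sub>v w) = (M * \<rho> g) *\<^sub>v w"
      using M \<rho> w by (simp add: W_def assoc_mult_mat_vec[of _ n n _ n])
    also have "\<dots> = \<rho> g *\<^sub>v (M *\<^sub>v w)"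
      using M \<rho> w by (simp add: W_def comm[OF g, symmetric] assoc_mult_mat_vec[of _ n n _ n])
    also have "\<dots> = \<mu> \<cdot>\<^sub>v (\<rho> g *\<^sub>v w)"
      using \<rho> w by (simp add: W_def mult_mat_vec[of _ n n])
    finally show "\<rho> g *\<^sub>v w \<in> W"
      using \<rho> w by (simp add: W_def)
  qed (use M in \<open>auto simp: W_def mult_add_distrib_mat_vec[of _ n n] smult_add_distrib_vec[of _ n]
      mult_mat_vec[of _ n n] smult_smult_assoc mult.commute\<close>)
  then have W: "W = carrier_vec n"
    using invariant_subspace_trivial[of W v] v by (simp add: W_def)
  have "M = \<mu> \<cdot>\<^sub>m 1\<^sub>m n"
  proof (rule eq_matI)
    fix i j assume ij: "i < dim_row (\<mu> \<cdot>\<^sub>m 1\<^sub>m n)" "j < dim_col (\<mu> \<cdot>\<^sub>m 1\<^sub>m n)"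
    have "unit_vec n j \<in> W" using W by auto
    then have "M *\<^sub>v unit_vec n j = \<mu> \<cdot>\<^sub>v unit_vec n j" by (simp add: W_def)
    then have "(M *\<^sub>v unit_vec n j) $ i = (\<mu> \<cdot>\<^sub>v unit_vec n j) $ i" by simp
    moreover have "(M *\<^sub>v unit_vec n j) $ i = M $$ (i, j)"
      using M ij by simp
    ultimately show "M $$ (i, j) = (\<mu> \<cdot>\<^sub>m 1\<^sub>m n) $$ (i, j)"
      using M ij by (auto simp: unit_vec_def)
  qed (use M in auto)
  then show thesis by (rule that)
qed

text \<open>The average of \<open>\<rho> g E \<rho> (g\<inverse>)\<close> over the group, for a matrix unit \<open>E\<close>, commutes with
  \<open>\<rho>\<close>. By Schur's lemma it is a scalar, and its trace tells which one.\<close>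

lemma schur_orthogonality:
  assumes "i < n" "j < n" "k < n" "l < n"
  shows "(\<Sum>g\<in>carrier G. \<rho> g $$ (i, j) * \<rho> (inv g) $$ (k, l)) =
    (if i = l \<and> j = k then of_nat (Coset.order G) / of_nat n else 0)"
proof -
  define F where "F = (\<lambda>i l. \<Sum>g\<in>carrier G. \<rho> g $$ (i, j) * \<rho> (inv g) $$ (k, l))"
  define M where "M = mat n n (\<lambda>(i, l). F i l)"
  have M: "M \<in> carrier_mat n n" by (simp add: M_def)
  have comm: "\<rho> h * M = M * \<rho> h" if h: "h \<in> carrier G" for h
  proof (rule eq_matI)
    fix a b assume "a < dim_row (M * \<rho> h)" "b < dim_col (M * \<rho> h)"
    then have ab: "a < n" "b < n" using rep_carrier[OF h] by (auto simp: M_def)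
    have "(\<rho> h * M) $$ (a, b) = (\<Sum>p<n. \<rho> h $$ (a, p) * F p b)"
      using ab rep_carrier[OF h] by (auto simp: M_def scalar_prod_def atLeast0LessThan)
    also have "\<dots> = (\<Sum>g\<in>carrier G. \<rho> (h \<otimes> g) $$ (a, j) * \<rho> (inv g) $$ (k, b))"
      unfolding F_def using h ab assms
      by (subst sum_distrib_left, subst sum.swap)
        (auto simp: entry_mult sum_distrib_left mult_ac intro!: sum.cong)
    also have "\<dots> = (\<Sum>g\<in>carrier G. \<rho> g $$ (a, j) * \<rho> (inv g \<otimes> h) $$ (k, b))"
      by (rule sum.reindex_bij_witness[where i = "\<lambda>g. inv h \<otimes> g" and j = "\<lambda>g. h \<otimes> g"])
        (use h in \<open>auto simp: m_assoc[symmetric] inv_mult_group\<close>, simp add: m_assoc)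
    also have "\<dots> = (\<Sum>p<n. F a p * \<rho> h $$ (p, b))"
      unfolding F_def using h ab assms
      by (subst sum_distrib_right, subst sum.swap)
        (auto simp: entry_mult sum_distrib_left mult_ac intro!: sum.cong)
    also have "\<dots> = (M * \<rho> h) $$ (a, b)"
      using ab rep_carrier[OF h] by (auto simp: M_def scalar_prod_def atLeast0LessThan)
    finally show "(\<rho> h * M) $$ (a, b) = (M * \<rho> h) $$ (a, b)" .
  qed (use M rep_carrier[OF h] in auto)
  obtain \<mu> where \<mu>: "M = \<mu> \<cdot>\<^sub>m 1\<^sub>m n" using schur[OF M comm] .
  have entries: "F a b = (if a = b then \<mu> else 0)" if "a < n" "b < n" for a b
  proof -
    have "F a b = M $$ (a, b)" using that by (simp add: M_def)
    then show ?thesis using that by (simp add: \<mu>)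
  qed
  have "of_nat n * \<mu> = (\<Sum>a<n. F a a)" by (simp add: entries)
  also have "\<dots> = (\<Sum>g\<in>carrier G. \<Sum>a<n. \<rho> (inv g) $$ (k, a) * \<rho> g $$ (a, j))"
    unfolding F_def by (subst sum.swap) (simp add: mult.commute)
  also have "\<dots> = (\<Sum>g\<in>carrier G. \<rho> (inv g \<otimes> g) $$ (k, j))"
    using assms by (intro sum.cong refl entry_mult[symmetric]) auto
  also have "\<dots> = (if j = k then of_nat (Coset.order G) else 0)"
    using assms by (simp add: entry_one Coset.order_def)
  finally have "\<mu> = (if j = k then of_nat (Coset.order G) / of_nat n else 0)"
    using degree_pos by (auto simp: field_simps split: if_splits)
  then show ?thesis using entries[OF assms(1,4)] by (simp add: F_def)
qed

text \<open>Orthogonality to a linear character \<open>\<phi>\<close>. The matrix \<open>\<Sum>g. \<phi> (g\<inverse>) \<rho> g\<close> has columns on which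
  \<open>\<rho>\<close> acts through \<open>\<phi>\<close>. A nonzero column would span an invariant line, so that \<open>\<rho>\<close> would be
  \<open>\<phi>\<close> itself.\<close>

lemma twisted_sum_eq_0:
  assumes mult: "\<And>g h. g \<in> carrier G \<Longrightarrow> h \<in> carrier G \<Longrightarrow> \<phi> (g \<otimes> h) = \<phi> g * \<phi> h"
    and one: "\<phi> \<one> = 1"
    and neq: "rep_character G n \<rho> \<noteq> restrict \<phi> (carrier G)"
  shows "(\<Sum>g\<in>carrier G. \<phi> (inv g) * rep_character G n \<rho> g) = 0"
proof -
  define N where "N = (\<lambda>i j. \<Sum>g\<in>carrier G. \<phi> (inv g) * \<rho> g $$ (i, j))"
  have twist: "(\<Sum>k<n. \<rho> h $$ (i, k) * N k j) = \<phi> h * N i j"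
    if h: "h \<in> carrier G" and ij: "i < n" "j < n" for h i j
  proof -
    have "(\<Sum>k<n. \<rho> h $$ (i, k) * N k j) = (\<Sum>g\<in>carrier G. \<phi> (inv g) * \<rho> (h \<otimes> g) $$ (i, j))"
      unfolding N_def using h ij
      by (subst sum_distrib_left, subst sum.swap)
        (auto simp: entry_mult sum_distrib_left mult_ac intro!: sum.cong)
    also have "\<dots> = (\<Sum>g\<in>carrier G. \<phi> (inv g \<otimes> h) * \<rho> g $$ (i, j))"
      by (rule sum.reindex_bij_witness[where i = "\<lambda>g. inv h \<otimes> g" and j = "\<lambda>g. h \<otimes> g"])
        (use h in \<open>auto simp: m_assoc[symmetric] inv_mult_group\<close>, simp add: m_assoc)
    also have "\<dots> = \<phi> h * N i j"
      unfolding N_def using h by (auto simp: mult sum_distrib_left mult_ac intro!: sum.cong)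
    finally show ?thesis .
  qed
  have "N i j = 0" if ij: "i < n" "j < n" for i j
  proof (rule ccontr)
    assume nz: "N i j \<noteq> 0"
    define w where "w = vec n (\<lambda>k. N k j)"
    have w: "w \<in> carrier_vec n" "w \<noteq> 0\<^sub>v n"
      using nz ij by (auto simp: w_def vec_eq_iff)
    have act: "\<rho> h *\<^sub>v w = \<phi> h \<cdot>\<^sub>v w" if "h \<in> carrier G" for h
    proof (rule eq_vecI)
      fix k assume "k < dim_vec (\<phi> h \<cdot>\<^sub>v w)"
      then have "k < n" by (simp add: w_def)
      then show "(\<rho> h *\<^sub>v w) $ k = (\<phi> h \<cdot>\<^sub>v w) $ k"
        using twist[OF that \<open>k < n\<close> ij(2)] rep_carrier[OF that]
        by (simp add: w_def scalar_prod_def atLeast0LessThan)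
    qed (use rep_carrier[OF that] in \<open>auto simp: w_def\<close>)
    define W where "W = {c \<cdot>\<^sub>v w | c. True}"
    have "invariant_subspace G n \<rho> W"
    proof (rule invariant_subspaceI)
      show "0\<^sub>v n \<in> W" using w by (auto simp: W_def intro!: exI[of _ 0])
      fix u v assume "u \<in> W" "v \<in> W"
      then obtain a b where "u = a \<cdot>\<^sub>v w" "v = b \<cdot>\<^sub>v w" by (auto simp: W_def)
      then have "u + v = (a + b) \<cdot>\<^sub>v w" by (simp add: add_smult_distrib_vec)
      then show "u + v \<in> W" by (auto simp: W_def)
    next
      fix g v assume g: "g \<in> carrier G" and "v \<in> W"
      then obtain a where "v = a \<cdot>\<^sub>v w" by (auto simp: W_def)
      then have "\<rho> g *\<^sub>v v = (a * \<phi> g) \<cdot>\<^sub>v w"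
        using rep_carrier[OF g] w act[OF g] by (simp add: mult_mat_vec[of _ n n] smult_smult_assoc)
      then show "\<rho> g *\<^sub>v v \<in> W" by (auto simp: W_def)
    qed (use w in \<open>auto simp: W_def smult_smult_assoc\<close>)
    moreover have "w \<in> W" by (auto simp: W_def intro!: exI[of _ 1])
    ultimately have W: "W = carrier_vec n" using invariant_subspace_trivial w by blast
    have "n = 1"
    proof (rule ccontr)
      assume "n \<noteq> 1"
      then have n: "1 < n" using degree_pos by simp
      have "unit_vec n 0 \<in> W" "unit_vec n 1 \<in> W" using W by auto
      then obtain a b where ab: "unit_vec n 0 = a \<cdot>\<^sub>v w" "unit_vec n 1 = b \<cdot>\<^sub>v w"
        by (auto simp: W_def)
      have "a * w $ 0 = 1" "b * w $ 0 = 0" "b * w $ 1 = 1"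
        using arg_cong[OF ab(1), of "\<lambda>v. v $ 0"] arg_cong[OF ab(2), of "\<lambda>v. v $ 0"]
          arg_cong[OF ab(2), of "\<lambda>v. v $ 1"] n w by auto
      then show False by auto
    qed
    have "\<rho> h $$ (0, 0) = \<phi> h" if "h \<in> carrier G" for h
    proof -
      have "w $ 0 \<noteq> 0" using w \<open>n = 1\<close> by (auto simp: vec_eq_iff)
      moreover have "(\<rho> h *\<^sub>v w) $ 0 = \<rho> h $$ (0, 0) * w $ 0"
        using rep_carrier[OF that] w \<open>n = 1\<close> by (simp add: scalar_prod_def)
      ultimately show ?thesis using act[OF that] w \<open>n = 1\<close> by auto
    qed
    with neq \<open>n = 1\<close> show False by (auto simp: rep_character_def)
  qed
  moreover have "(\<Sum>g\<in>carrier G. \<phi> (inv g) * rep_character G n \<rho> g) = (\<Sum>i<n. N i i)"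
    unfolding N_def by (subst sum.swap) (simp add: rep_character_def sum_distrib_left)
  ultimately show ?thesis by simp
qed

end

section \<open>Divisibility properties of character degrees\<close>

text \<open>The number is a root of the characteristic polynomial of an integral matrix, which is monic.
  The matrix is indexed by an arbitrary finite set, since below it acts on functions on
  \<open>G \<times> G\<close>.\<close>

lemma algebraic_int_of_integral_eigenvector:
  fixes F :: "'i \<Rightarrow> complex" and a :: "'i \<Rightarrow> 'i \<Rightarrow> int"
  assumes fin: "finite I" and nz: "i0 \<in> I" "F i0 \<noteq> 0"
    and eig: "\<And>i. i \<in> I \<Longrightarrow> x * F i = (\<Sum>j\<in>I. of_int (a i j) * F j)"
  shows "algebraic_int x"
proof -
  define N where "N = card I"
  obtain e where e: "bij_betw e {..<N} I"
    using ex_bij_betw_nat_finite[OF fin] by (auto simp: N_def atLeast0LessThan)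
  define A where "A = mat N N (\<lambda>(i, j). a (e i) (e j))"
  define v where "v = vec N (\<lambda>i. F (e i))"
  let ?A = "map_mat of_int A :: complex mat"
  have A: "A \<in> carrier_mat N N" by (simp add: A_def)
  have "?A *\<^sub>v v = x \<cdot>\<^sub>v v"
  proof (rule eq_vecI)
    fix i assume "i < dim_vec (x \<cdot>\<^sub>v v)"
    then have i: "i < N" by (simp add: v_def)
    then have "e i \<in> I" using e by (auto simp: bij_betw_def)
    have "(?A *\<^sub>v v) $ i = (\<Sum>j<N. of_int (a (e i) (e j)) * F (e j))"
      using i by (simp add: A_def v_def scalar_prod_def atLeast0LessThan)
    also have "\<dots> = (\<Sum>j\<in>I. of_int (a (e i) j) * F j)"
      by (rule sum.reindex_bij_betw[OF e])
    finally show "(?A *\<^sub>v v) $ i = (x \<cdot>\<^sub>v v) $ i"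
      using i eig[OF \<open>e i \<in> I\<close>] by (simp add: v_def)
  qed (simp add: A_def v_def)
  moreover have "v \<noteq> 0\<^sub>v N"
  proof
    assume v: "v = 0\<^sub>v N"
    obtain k where "k < N" "e k = i0" using e nz(1) by (auto simp: bij_betw_def)
    then show False using arg_cong[OF v, of "\<lambda>v. v $ k"] nz by (simp add: v_def)
  qed
  ultimately have "eigenvalue ?A x"
    by (auto simp: eigenvalue_def eigenvector_def A_def v_def intro!: exI[of _ v])
  then have "poly (char_poly ?A) x = 0"
    using eigenvalue_root_char_poly[of ?A N] A by auto
  then have "poly (of_int_poly (char_poly A)) x = 0"
    by (simp add: of_int_hom.char_poly_hom[OF A])
  moreover have "lead_coeff (char_poly A) = 1"
    using degree_monic_char_poly[OF A] by simp
  ultimately show ?thesis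
    by (auto simp: algebraic_int_altdef_ipoly)
qed

text \<open>Triangularise by Schur's decomposition: the diagonal entries of an idempotent triangular matrix
  are \<open>0\<close> or \<open>1\<close>.\<close>

lemma idempotent_trace_Nats:
  fixes E :: "complex mat"
  assumes E: "E \<in> carrier_mat n n" and idem: "E * E = E"
  shows "(\<Sum>i<n. E $$ (i, i)) \<in> \<nat>"
proof -
  obtain es where "char_poly E = (\<Prod>a\<leftarrow>es. [:- a, 1:])"
    using char_poly_factorized[OF E] by auto
  then obtain B where B: "B \<in> carrier_mat n n" "upper_triangular B" and "similar_mat E B"
    using schur_decomposition_exists[OF E] by blast
  then obtain P Q where "similar_mat_wit E B P Q" by (auto simp: similar_mat_def)
  then have PQ: "P \<in> carrier_mat n n" "Q \<in> carrier_mat n n" "Q * P = 1\<^sub>m n" "E = P * B * Q"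
    using E by (auto simp: similar_mat_wit_def Let_def)
  note assoc = assoc_mult_mat[of _ n n _ n _ n]
  have "Q * (E * P) = Q * P * (B * (Q * P))"
    using PQ(1,2) B by (simp add: PQ(4) assoc)
  then have B_eq: "B = Q * (E * P)" using PQ B by simp
  have "B * B = Q * (E * (P * Q * (E * P)))"
    using PQ(1,2) E B by (simp add: B_eq assoc)
  also have "P * Q = 1\<^sub>m n"
    using PQ by (metis mat_mult_left_right_inverse)
  also have "Q * (E * (1\<^sub>m n * (E * P))) = Q * (E * E * P)"
    using PQ(1,2) E by (simp add: assoc)
  finally have idem_B: "B * B = B" by (simp add: idem B_eq)
  have diag: "B $$ (i, i) = 0 \<or> B $$ (i, i) = 1" if i: "i < n" for i
  proof -
    have "B $$ (i, i) = (\<Sum>k<n. B $$ (i, k) * B $$ (k, i))"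
      using arg_cong[OF idem_B, of "\<lambda>M. M $$ (i, i)"] B i
      by (simp add: scalar_prod_def atLeast0LessThan)
    also have "\<dots> = (\<Sum>k<n. if k = i then B $$ (i, i) * B $$ (i, i) else 0)"
    proof (intro sum.cong refl)
      fix k assume "k \<in> {..<n}"
      then show "B $$ (i, k) * B $$ (k, i) = (if k = i then B $$ (i, i) * B $$ (i, i) else 0)"
        using B i by (cases k i rule: linorder_cases) (auto simp: upper_triangular_def)
    qed
    finally show ?thesis using i by simp
  qed
  have "(\<Sum>i<n. E $$ (i, i)) = (\<Sum>i<n. \<Sum>k<n. P $$ (i, k) * (B * Q) $$ (k, i))"
    using PQ(1,2) B by (simp add: PQ(4) assoc scalar_prod_def atLeast0LessThan)
  also have "\<dots> = (\<Sum>k<n. \<Sum>i<n. (B * Q) $$ (k, i) * P $$ (i, k))"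
    by (subst sum.swap) (simp add: mult.commute)
  also have "\<dots> = (\<Sum>k<n. (B * Q * P) $$ (k, k))"
  proof (intro sum.cong refl)
    fix k assume "k \<in> {..<n}"
    moreover obtain C where C: "C = B * Q" "C \<in> carrier_mat n n" using PQ(2) B by auto
    ultimately show "(\<Sum>i<n. (B * Q) $$ (k, i) * P $$ (i, k)) = (B * Q * P) $$ (k, k)"
      using PQ(1) by (simp flip: C(1)) (simp add: scalar_prod_def atLeast0LessThan)
  qed
  also have "B * Q * P = B"
    using PQ B by (simp add: assoc)
  also have "(\<Sum>k<n. B $$ (k, k)) = of_nat (\<Sum>k<n. if B $$ (k, k) = 0 then 0 else 1)"
    unfolding of_nat_sum by (intro sum.cong refl) (use diag in auto)
  finally show ?thesis by (simp del: of_nat_sum)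
qed

context irreducible_rep
begin

text \<open>By Schur orthogonality, \<open>F (a, b) = \<rho>\<^sub>0\<^sub>0 a \<rho>\<^sub>0\<^sub>0 b\<close> satisfies
  \<open>\<Sum>g. F (g a, g\<inverse> b) = (|G| / n) F (a, b)\<close>. So \<open>|G| / n\<close> is an eigenvalue of an integral matrix,
  hence an algebraic integer, and it is rational. This avoids the integrality of character
  values.\<close>

lemma degree_dvd_order: "n dvd Coset.order G"
proof -
  define F where "F = (\<lambda>(a, b). \<rho> a $$ (0, 0) * \<rho> b $$ (0, 0))"
  define I where "I = carrier G \<times> carrier G"
  define c where "c = (\<lambda>(a, b) q. int (card {g \<in> carrier G. (g \<otimes> a, inv g \<otimes> b) = q}))"
  define x :: complex where "x = of_nat (Coset.order G) / of_nat n"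
  have fin: "finite I" using finite_carrier by (simp add: I_def)
  have "algebraic_int x"
  proof (rule algebraic_int_of_integral_eigenvector[OF fin])
    show "(\<one>, \<one>) \<in> I" "F (\<one>, \<one>) \<noteq> 0"
      using degree_pos by (auto simp: I_def F_def entry_one)
    fix p assume "p \<in> I"
    then obtain a b where p: "p = (a, b)" and ab: "a \<in> carrier G" "b \<in> carrier G"
      by (auto simp: I_def)
    have "(\<Sum>g\<in>carrier G. F (g \<otimes> a, inv g \<otimes> b)) =
        (\<Sum>g\<in>carrier G. \<Sum>i<n. \<Sum>j<n.
          \<rho> a $$ (i, 0) * \<rho> b $$ (j, 0) * (\<rho> g $$ (0, i) * \<rho> (inv g) $$ (0, j)))"
      using degree_pos ab
      by (auto simp: F_def entry_mult sum_product mult_ac intro!: sum.cong)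
    also have "\<dots> = (\<Sum>i<n. \<Sum>j<n. \<rho> a $$ (i, 0) * \<rho> b $$ (j, 0) *
        (\<Sum>g\<in>carrier G. \<rho> g $$ (0, i) * \<rho> (inv g) $$ (0, j)))"
      by (subst sum.swap, intro sum.cong refl, subst sum.swap) (simp add: sum_distrib_left)
    also have "\<dots> = (\<Sum>i<n. \<Sum>j<n. if j = 0 then if i = 0 then x * F p else 0 else 0)"
      using degree_pos
      by (intro sum.cong refl) (auto simp: schur_orthogonality x_def F_def p)
    also have "\<dots> = x * F p" using degree_pos by simp
    finally have "x * F p = (\<Sum>g\<in>carrier G. F (g \<otimes> a, inv g \<otimes> b))" by simp
    also have "\<dots> = (\<Sum>q\<in>I. \<Sum>g\<in>{g \<in> carrier G. (g \<otimes> a, inv g \<otimes> b) = q}. F (g \<otimes> a, inv g \<otimes> b))"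
      by (rule sum.group[symmetric]) (use ab finite_carrier fin in \<open>auto simp: I_def\<close>)
    also have "\<dots> = (\<Sum>q\<in>I. of_int (c p q) * F q)"
      by (auto simp: c_def p intro!: sum.cong)
    finally show "x * F p = (\<Sum>q\<in>I. of_int (c p q) * F q)" .
  qed
  moreover have "x \<in> \<rat>" by (auto simp: x_def)
  ultimately have "x \<in> \<int>" by (rule rational_algebraic_int_is_int)
  then obtain z where "x = of_int z" by (auto elim: Ints_cases)
  then have "(of_int (int (Coset.order G)) :: complex) = of_int (z * int n)"
    using degree_pos by (auto simp: x_def field_simps)
  then have "int (Coset.order G) = z * int n" by (simp only: of_int_eq_iff)
  then show ?thesis by (metis dvd_triv_right int_dvd_int_iff)
qed

end

context irreducible_rep
begin

text \<open>The average of \<open>\<rho>\<close> over \<open>H\<close> is idempotent. Its trace, the multiplicity of the trivial character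
  in the restriction to \<open>H\<close>, is \<open>n / |H|\<close> when only \<open>\<one>\<close> contributes to it.\<close>

lemma card_subgroup_dvd_degree:
  assumes H: "subgroup H G"
    and van: "\<And>g. g \<in> H \<Longrightarrow> g \<noteq> \<one> \<Longrightarrow> rep_character G n \<rho> g = 0"
  shows "card H dvd n"
proof -
  have HG: "H \<subseteq> carrier G" using subgroup.subset[OF H] .
  have fin: "finite H" using HG finite_carrier finite_subset by blast
  have pos: "card H > 0" using fin subgroup.one_closed[OF H] by (auto simp: card_gt_0_iff)
  define E where "E = mat n n (\<lambda>(i, j). (\<Sum>g\<in>H. \<rho> g $$ (i, j)) / of_nat (card H))"
  have E: "E \<in> carrier_mat n n" by (simp add: E_def)
  have idem: "E * E = E"
  proof (rule eq_matI)
    fix i j assume "i < dim_row E" "j < dim_col E"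
    then have ij: "i < n" "j < n" by (auto simp: E_def)
    have "(E * E) $$ (i, j) =
        (\<Sum>k<n. (\<Sum>g\<in>H. \<rho> g $$ (i, k)) * (\<Sum>h\<in>H. \<rho> h $$ (k, j))) / (of_nat (card H))\<^sup>2"
      using ij by (simp add: E_def scalar_prod_def atLeast0LessThan power2_eq_square
          flip: sum_divide_distrib)
    also have "(\<Sum>k<n. (\<Sum>g\<in>H. \<rho> g $$ (i, k)) * (\<Sum>h\<in>H. \<rho> h $$ (k, j))) =
        (\<Sum>g\<in>H. \<Sum>h\<in>H. \<Sum>k<n. \<rho> g $$ (i, k) * \<rho> h $$ (k, j))"
      unfolding sum_product by (subst sum.swap, intro sum.cong refl, rule sum.swap)
    also have "\<dots> = (\<Sum>g\<in>H. \<Sum>h\<in>H. \<rho> (g \<otimes> h) $$ (i, j))"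
      using ij subsetD[OF HG] by (intro sum.cong refl) (simp add: entry_mult)
    also have "\<dots> = (\<Sum>g\<in>H. \<Sum>h\<in>H. \<rho> h $$ (i, j))"
    proof (rule sum.cong[OF refl])
      fix g assume g: "g \<in> H"
      show "(\<Sum>h\<in>H. \<rho> (g \<otimes> h) $$ (i, j)) = (\<Sum>h\<in>H. \<rho> h $$ (i, j))"
        by (rule sum.reindex_bij_witness[where i = "\<lambda>h. inv g \<otimes> h" and j = "\<lambda>h. g \<otimes> h"])
          (use g HG in \<open>auto simp: subset_iff subgroup.m_closed[OF H] subgroup.m_inv_closed[OF H]
              m_assoc[symmetric]\<close>)
    qed
    also have "\<dots> / (of_nat (card H))\<^sup>2 = E $$ (i, j)"
      using ij pos by (simp add: E_def power2_eq_square)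
    finally show "(E * E) $$ (i, j) = E $$ (i, j)" .
  qed (auto simp: E_def)
  have "(\<Sum>i<n. E $$ (i, i)) = (\<Sum>g\<in>H. rep_character G n \<rho> g) / of_nat (card H)"
    using HG by (simp add: E_def rep_character_def subset_iff sum_divide_distrib[symmetric])
      (subst sum.swap, simp)
  also have "(\<Sum>g\<in>H. rep_character G n \<rho> g) = (\<Sum>g\<in>H. if g = \<one> then of_nat n else 0)"
    by (intro sum.cong refl) (auto simp: van character_one)
  also have "\<dots> = of_nat n" using fin subgroup.one_closed[OF H] by simp
  finally obtain k where "(of_nat n :: complex) / of_nat (card H) = of_nat k"
    using idempotent_trace_Nats[OF E idem] by (auto elim: Nats_cases)
  then have "(of_nat n :: complex) = of_nat (k * card H)"
    using pos by (simp add: field_simps)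
  then have "n = k * card H" by (simp only: of_nat_eq_iff)
  then show ?thesis by simp
qed

text \<open>The character vanishes on a Sylow subgroup outside \<open>\<one>\<close>, so that \<open>|G|\<^sub>p\<close> divides the degree, and the
  degree divides \<open>|G|\<close>. In other words, the \<open>p\<close>-defect is zero.\<close>

lemma multiplicity_degree_eq_multiplicity_order:
  assumes p: "prime p"
    and van: "\<And>g. g \<in> p_singular_elements p G \<Longrightarrow> rep_character G n \<rho> g = 0"
  shows "multiplicity p n = multiplicity p (Coset.order G)"
proof -
  have pos: "Coset.order G > 0" using finite_carrier by (simp add: order_gt_0_iff_finite)
  define a where "a = multiplicity p (Coset.order G)"
  obtain m where "Coset.order G = p ^ a * m"
    using multiplicity_dvd[of p "Coset.order G"] by (auto simp: a_def)
  then obtain H where H: "subgroup H G" "card H = p ^ a"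
    using sylow_thm[OF p is_group _ finite_carrier] by blast
  have "rep_character G n \<rho> g = 0" if g: "g \<in> H" "g \<noteq> \<one>" for g
  proof -
    have gG: "g \<in> carrier G" using g subgroup.subset[OF H(1)] by auto
    interpret H: group "G\<lparr>carrier := H\<rparr>" by (rule subgroup.subgroup_is_group[OF H(1) is_group])
    have "g [^]\<^bsub>G\<lparr>carrier := H\<rparr>\<^esub> card H = \<one>"
      using H.pow_order_eq_1[of g] g by (simp add: Coset.order_def)
    then have "g [^] (p ^ a) = \<one>"
      using nat_pow_consistent[of g "card H" H] H(2) by simp
    then have "ord g dvd p ^ a" using gG pow_eq_id by blast
    moreover have "ord g \<noteq> 1" using ord_eq_1 gG g by blast
    ultimately have "p dvd ord g"
      using p by (metis divides_primepow_nat dvd_power not_gr_zero power_0)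
    then show ?thesis using gG by (intro van) (simp add: p_singular_elements_def)
  qed
  then have "p ^ a dvd n" using card_subgroup_dvd_degree[OF H(1)] H(2) by simp
  then have "a \<le> multiplicity p n"
    using p degree_pos by (intro multiplicity_geI) (auto simp: prime_gt_1_nat)
  moreover have "multiplicity p n \<le> a"
    unfolding a_def using degree_dvd_order pos by (intro dvd_imp_multiplicity_le) auto
  ultimately show ?thesis by (simp add: a_def)
qed

end

section \<open>Sign characters and 2-constant characters\<close>

lemma irreducible_charactersE:
  assumes "group G" "finite (carrier G)" "\<chi> \<in> irreducible_characters G"
  obtains n \<rho> where "irreducible_rep G n \<rho>" "\<chi> = rep_character G n \<rho>"
  using assms
  by (auto simp: irreducible_characters_def irreducible_rep_def matrix_rep_def matrix_rep_axioms_def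
      irreducible_rep_axioms_def irreducible_representation_def)

lemma (in group) linear_character:
  assumes fin: "finite (carrier G)"
    and mult: "\<And>g h. g \<in> carrier G \<Longrightarrow> h \<in> carrier G \<Longrightarrow> \<phi> (g \<otimes> h) = \<phi> g * \<phi> h"
    and one: "\<phi> \<one> = 1"
  shows "restrict \<phi> (carrier G) \<in> linear_characters G"
proof -
  define \<rho> where "\<rho> = (\<lambda>g. mat 1 1 (\<lambda>_. \<phi> g :: complex))"
  have times: "\<rho> g * \<rho> h = mat 1 1 (\<lambda>_. \<phi> g * \<phi> h)" for g h
    by (rule eq_matI) (auto simp: \<rho>_def scalar_prod_def)
  have unit: "mat 1 1 (\<lambda>_. 1) = (1\<^sub>m 1 :: complex mat)"
    by (rule eq_matI) auto
  have "\<rho> g \<in> carrier (GL 1)" if "g \<in> carrier G" for g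
  proof -
    have "\<rho> g * \<rho> (inv g) = 1\<^sub>m 1" "\<rho> (inv g) * \<rho> g = 1\<^sub>m 1"
      using that one unit by (simp_all add: times mult[symmetric])
    moreover have "\<rho> h \<in> carrier_mat 1 1" for h by (simp add: \<rho>_def)
    ultimately show ?thesis
      by (auto simp: GL_def units_of_def Units_def ring_mat_simps)
  qed
  then have hom: "\<rho> \<in> hom G (GL 1)"
    by (auto simp: hom_def times mult) (simp add: \<rho>_def mult)
  have "W = {0\<^sub>v 1} \<or> W = carrier_vec 1" if "invariant_subspace G 1 \<rho> W" for W
  proof -
    have "submodule class_ring W (module_vec TYPE(complex) 1)"
      using that by (auto simp: invariant_subspace_def VectorSpace.subspace_def)
    note W = submodule.subset[OF this] submodule.zero_closed[OF this] submodule.smult_closed[OF this]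
    have "W = carrier_vec 1" if w: "w \<in> W" "w \<noteq> 0\<^sub>v 1" for w
    proof -
      have "w \<in> carrier_vec 1" using w W(1) by (auto simp: module_vec_simps)
      then have "w $ 0 \<noteq> 0" using w(2) by (auto simp: vec_eq_iff)
      have "v \<in> W" if v: "v \<in> carrier_vec 1" for v
      proof -
        have "v = (v $ 0 / w $ 0) \<cdot>\<^sub>v w"
          using v \<open>w \<in> carrier_vec 1\<close> \<open>w $ 0 \<noteq> 0\<close> by (intro eq_vecI) auto
        then show ?thesis using W(3)[of "v $ 0 / w $ 0" w] w(1) by (simp add: module_vec_simps)
      qed
      then show ?thesis using W(1) by (auto simp: module_vec_simps)
    qed
    then show ?thesis using W(2) by (auto simp: module_vec_simps)
  qed
  then have irr: "irreducible_representation G 1 \<rho>"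
    using hom by (simp add: irreducible_representation_def)
  interpret matrix_rep G 1 \<rho> by unfold_locales (fact fin hom)+
  have eq: "restrict \<phi> (carrier G) = rep_character G 1 \<rho>"
    by (auto simp: rep_character_def \<rho>_def)
  show ?thesis
    using irr character_degree by (auto simp: linear_characters_def irreducible_characters_def eq)
qed

text \<open>A homomorphism onto \<open>{1, -1}\<close>. Its values are complex numbers because it is compared with
  characters.\<close>

locale sign_character = group G for G (structure) +
  fixes \<epsilon> :: "_ \<Rightarrow> complex"
  assumes finite_carrier: "finite (carrier G)"
    and sign_mult: "\<And>g h. g \<in> carrier G \<Longrightarrow> h \<in> carrier G \<Longrightarrow> \<epsilon> (g \<otimes> h) = \<epsilon> g * \<epsilon> h"
    and sign_cases: "\<And>g. g \<in> carrier G \<Longrightarrow> \<epsilon> g = 1 \<or> \<epsilon> g = -1"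
    and sign_nontrivial: "\<exists>g\<in>carrier G. \<epsilon> g = -1"
begin

lemma sign_one: "\<epsilon> \<one> = 1"
  using sign_mult[of \<one> \<one>] sign_cases[of \<one>] by auto

lemma sign_inv: "g \<in> carrier G \<Longrightarrow> \<epsilon> (inv g) = \<epsilon> g"
  using sign_mult[of g "inv g"] sign_cases[of g] sign_one by (auto simp: minus_equation_iff)

lemma sign_pow: "g \<in> carrier G \<Longrightarrow> \<epsilon> (g [^] (k::nat)) = \<epsilon> g ^ k"
  by (induction k) (auto simp: sign_one sign_mult)

text \<open>The order \<open>m\<close> of the element is even because \<open>(-1)\<^sup>m = \<epsilon> (g\<^sup>m) = 1\<close>.\<close>

lemma negative_2_singular:
  assumes "g \<in> carrier G" "\<epsilon> g = -1"
  shows "g \<in> p_singular_elements 2 G"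
proof -
  have "(-1 :: complex) ^ ord g = 1" using sign_pow[of g "ord g"] assms by (simp add: sign_one)
  then show ?thesis using assms by (auto simp: p_singular_elements_def minus_one_power_iff split: if_splits)
qed

lemma even_order: "2 dvd Coset.order G"
proof -
  obtain s where "s \<in> carrier G" "\<epsilon> s = -1" using sign_nontrivial by auto
  then show ?thesis
    using negative_2_singular[of s] ord_dvd_group_order[of s]
    by (auto simp: p_singular_elements_def intro: dvd_trans)
qed

lemma linear_in_Upsilon:
  assumes "\<chi> \<in> linear_characters G" "p_constant 2 G \<chi>"
  shows "\<chi> \<in> Upsilon 2 G"
proof -
  have "Coset.order G > 0" using finite_carrier by (simp add: order_gt_0_iff_finite)
  then have "multiplicity 2 (Coset.order G) > 0" using even_order by (simp add: multiplicity_gt_zero_iff)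
  then show ?thesis
    using assms by (simp add: linear_characters_def Upsilon_def p_defect_def)
qed

lemma principal_linear: "principal_character G \<in> linear_characters G"
  unfolding principal_character_def by (intro linear_character finite_carrier) auto

lemma sign_linear: "restrict \<epsilon> (carrier G) \<in> linear_characters G"
  by (intro linear_character finite_carrier sign_mult sign_one)

lemma principal_in_Upsilon: "principal_character G \<in> Upsilon 2 G"
  by (intro linear_in_Upsilon principal_linear)
    (auto simp: p_constant_def principal_character_def p_singular_elements_def)

text \<open>Let \<open>\<chi>\<close> take the value \<open>c\<close> on the \<open>2\<close>-singular elements and be orthogonal both to the principal
  character and to \<open>\<epsilon>\<close>. Then \<open>\<Sum>g. (1 - \<epsilon> g) \<chi> g = 0\<close>. Only the elements of sign \<open>-1\<close> contribute,
  and these are \<open>2\<close>-singular, so the sum is a positive multiple of \<open>2 c\<close>. Hence \<open>c = 0\<close>, and \<open>\<chi>\<close> has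
  defect zero.\<close>

lemma Upsilon_subset: "Upsilon 2 G \<subseteq> {principal_character G, restrict \<epsilon> (carrier G)}"
proof
  fix \<chi> assume \<chi>: "\<chi> \<in> Upsilon 2 G"
  then have "\<chi> \<in> irreducible_characters G" by (simp add: Upsilon_def)
  then obtain n \<rho> where "irreducible_rep G n \<rho>" and \<chi>_eq: "\<chi> = rep_character G n \<rho>"
    by (rule irreducible_charactersE[OF is_group finite_carrier])
  then interpret irreducible_rep G n \<rho> by simp
  obtain c where c: "\<And>g. g \<in> p_singular_elements 2 G \<Longrightarrow> \<chi> g = c"
    using \<chi> by (auto simp: Upsilon_def p_constant_def)
  show "\<chi> \<in> {principal_character G, restrict \<epsilon> (carrier G)}"
  proof (rule ccontr)
    assume neq: "\<chi> \<notin> {principal_character G, restrict \<epsilon> (carrier G)}"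
    have "(\<Sum>g\<in>carrier G. \<chi> g) = 0"
      using twisted_sum_eq_0[of "\<lambda>_. 1"] neq by (simp add: \<chi>_eq principal_character_def)
    moreover have "(\<Sum>g\<in>carrier G. \<epsilon> (inv g) * \<chi> g) = 0"
      using twisted_sum_eq_0[OF sign_mult sign_one] neq by (simp add: \<chi>_eq)
    ultimately have "0 = (\<Sum>g\<in>carrier G. \<chi> g - \<epsilon> (inv g) * \<chi> g)"
      by (simp add: sum_subtractf)
    also have "\<dots> = (\<Sum>g\<in>carrier G. if \<epsilon> g = -1 then 2 * c else 0)"
    proof (rule sum.cong[OF refl])
      fix g assume g: "g \<in> carrier G"
      show "\<chi> g - \<epsilon> (inv g) * \<chi> g = (if \<epsilon> g = -1 then 2 * c else 0)"
        using sign_cases[OF g] c[OF negative_2_singular[OF g]] by (auto simp: sign_inv[OF g])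
    qed
    also have "\<dots> = of_nat (card {g \<in> carrier G. \<epsilon> g = -1}) * (2 * c)"
      using finite_carrier by (simp flip: sum.inter_filter)
    finally have "c = 0"
      using sign_nontrivial finite_carrier by auto
    then have "multiplicity 2 n = multiplicity 2 (Coset.order G)"
      using c by (intro multiplicity_degree_eq_multiplicity_order) (auto simp: \<chi>_eq)
    then show False
      using \<chi> character_degree by (simp add: Upsilon_def p_defect_def \<chi>_eq)
  qed
qed

lemma sign_not_principal: "restrict \<epsilon> (carrier G) \<noteq> principal_character G"
proof
  assume eq: "restrict \<epsilon> (carrier G) = principal_character G"
  obtain s where "s \<in> carrier G" "\<epsilon> s = -1" using sign_nontrivial by auto
  then show False using fun_cong[OF eq, of s] by (simp add: principal_character_def)
qed

lemma Upsilon_nonprincipal_imp_odd: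
  assumes "Upsilon 2 G \<noteq> {principal_character G}" and g: "g \<in> carrier G" "\<epsilon> g = 1"
  shows "odd (ord g)"
proof
  assume "even (ord g)"
  obtain s where s: "s \<in> carrier G" "\<epsilon> s = -1" using sign_nontrivial by auto
  have "restrict \<epsilon> (carrier G) \<in> Upsilon 2 G"
    using assms(1) Upsilon_subset principal_in_Upsilon by blast
  then obtain c where "\<forall>g\<in>p_singular_elements 2 G. restrict \<epsilon> (carrier G) g = c"
    by (auto simp: Upsilon_def p_constant_def)
  then have "restrict \<epsilon> (carrier G) g = restrict \<epsilon> (carrier G) s"
    using negative_2_singular[OF s] g \<open>even (ord g)\<close> by (simp add: p_singular_elements_def)
  then show False using g s by simp
qed

lemma Upsilon_eq_pair:
  assumes "\<And>g. g \<in> carrier G \<Longrightarrow> \<epsilon> g = 1 \<Longrightarrow> odd (ord g)"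
  shows "Upsilon 2 G = {principal_character G, restrict \<epsilon> (carrier G)}"
proof -
  have "p_constant 2 G (restrict \<epsilon> (carrier G))"
    unfolding p_constant_def
    by (rule exI[of _ "-1"]) (use assms sign_cases in \<open>auto simp: p_singular_elements_def\<close>)
  then show ?thesis
    using Upsilon_subset principal_in_Upsilon linear_in_Upsilon[OF sign_linear] by auto
qed

end

section \<open>Dihedral groups of order twice an odd number\<close>

lemma (in irreducible_rep) linear_character_mult:
  assumes "n = 1" "g \<in> carrier G" "h \<in> carrier G"
  shows "rep_character G n \<rho> (g \<otimes> h) = rep_character G n \<rho> g * rep_character G n \<rho> h"
  using assms by (simp add: rep_character_def entry_mult)

text \<open>The sign character is \<open>-1\<close> on the reflections. The rotations have odd order because their
  \<open>n\<close>-th power is trivial, so both linear characters are \<open>2\<close>-constant. There are no others: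
  a linear character takes a rotation to an \<open>n\<close>-th root of unity that equals its own inverse.\<close>

lemma odd_dihedral_Upsilon:
  fixes G (structure)
  assumes grp: "group G" and n: "odd n" and iso: "G \<cong> dihedral_group n"
  shows "Upsilon 2 G = linear_characters G" and "card (linear_characters G) = 2"
proof -
  interpret group G by (rule grp)
  obtain f where hom: "f \<in> hom G (dihedral_group n)"
    and bij: "bij_betw f (carrier G) (carrier (dihedral_group n))"
    using iso by (auto simp: is_iso_def iso_def)
  have n_pos: "n > 0" using n by (cases n) auto
  have f_mult: "f (g \<otimes> h) = f g \<otimes>\<^bsub>dihedral_group n\<^esub> f h"
    if "g \<in> carrier G" "h \<in> carrier G" for g h
    using hom that by (simp add: hom_def)
  have f_carrier: "f g \<in> {0..<int n} \<times> UNIV" if "g \<in> carrier G" for g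
    using hom that by (auto simp: hom_def dihedral_group_def)
  have f_eqD: "g = h" if "f g = f h" "g \<in> carrier G" "h \<in> carrier G" for g h
    using bij that by (auto simp: bij_betw_def dest: inj_onD)
  have f_one: "f \<one> = (0, False)"
  proof -
    obtain a s where as: "f \<one> = (a, s)" by force
    have "(a, s) = (a, s) \<otimes>\<^bsub>dihedral_group n\<^esub> (a, s)"
      using f_mult[of \<one> \<one>] by (simp add: as)
    also have "\<dots> = ((if s then a - a else a + a) mod int n, False)"
      by (simp add: dihedral_group_def)
    finally have "\<not> s" "a = (a + a) mod int n" by (metis prod.inject)+
    moreover have "0 \<le> a" "a < int n" using f_carrier[of \<one>] by (auto simp: as)
    moreover have "int n dvd a + a - (a + a) mod int n" by (rule dvd_minus_mod)
    ultimately have "a = 0" using zdvd_imp_le[of "int n" a] by force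
    with \<open>\<not> s\<close> as show ?thesis by simp
  qed
  define \<epsilon> :: "_ \<Rightarrow> complex" where "\<epsilon> = (\<lambda>g. if snd (f g) then -1 else 1)"
  obtain t where t: "t \<in> carrier G" "f t = (0, True)"
  proof -
    have "(0, True) \<in> carrier (dihedral_group n)" using n_pos by (simp add: dihedral_group_def)
    then show thesis using bij that unfolding bij_betw_def by (metis imageE)
  qed
  interpret sign_character G \<epsilon>
  proof
    show "finite (carrier G)"
      using bij_betw_finite[OF bij] by (simp add: dihedral_group_def)
    show "\<epsilon> (g \<otimes> h) = \<epsilon> g * \<epsilon> h" if "g \<in> carrier G" "h \<in> carrier G" for g h
      using f_mult[OF that] by (auto simp: \<epsilon>_def dihedral_group_def split: prod.splits)
    show "\<exists>g\<in>carrier G. \<epsilon> g = -1"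
      using t by (auto simp: \<epsilon>_def intro!: bexI[of _ t])
  qed (auto simp: \<epsilon>_def)
  have rot: "g [^] n = \<one>" if g: "g \<in> carrier G" "\<epsilon> g = 1" for g
  proof -
    obtain a where a: "f g = (a, False)"
      using g by (cases "f g") (auto simp: \<epsilon>_def split: if_splits)
    have "f (g [^] k) = ((int k * a) mod int n, False)" for k :: nat
    proof (induction k)
      case (Suc k)
      then show ?case
        using f_mult[of "g [^] k" g] g
        by (simp add: a dihedral_group_def mod_add_left_eq mod_add_right_eq algebra_simps)
    qed (simp add: f_one)
    then show ?thesis using f_eqD[of "g [^] n" \<one>] f_one g by simp
  qed
  have odd_ord: "odd (ord g)" if "g \<in> carrier G" "\<epsilon> g = 1" for g
    using rot[OF that] that n pow_eq_id[of g n] by (meson dvd_trans)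
  have "\<chi> \<in> {principal_character G, restrict \<epsilon> (carrier G)}" if \<chi>: "\<chi> \<in> linear_characters G" for \<chi>
  proof -
    have "\<chi> \<in> irreducible_characters G" using \<chi> by (simp add: linear_characters_def)
    then obtain d \<rho> where "irreducible_rep G d \<rho>" and \<chi>_eq: "\<chi> = rep_character G d \<rho>"
      by (rule irreducible_charactersE[OF is_group finite_carrier])
    then interpret irreducible_rep G d \<rho> by simp
    have d: "d = 1" using \<chi> character_degree by (simp add: linear_characters_def \<chi>_eq)
    note mult = linear_character_mult[OF d, folded \<chi>_eq]
    have one: "\<chi> \<one> = 1" using character_one d by (simp add: \<chi>_eq)
    have pow: "\<chi> (g [^] (k::nat)) = \<chi> g ^ k" if "g \<in> carrier G" for g k
      by (induction k) (use that one in \<open>auto simp: mult\<close>)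
    have tt: "t \<otimes> t = \<one>" 
      using f_eqD[of "t \<otimes> t" \<one>] f_mult[of t t] t f_one by (simp add: dihedral_group_def)
    then have \<chi>t: "\<chi> t * \<chi> t = 1" using mult[of t t] t one by simp
    \<comment> \<open>\<open>t\<close> inverts \<open>g\<close>, so \<open>\<chi> g\<close> is its own inverse as well as an \<open>n\<close>-th root of unity\<close>
    have pos: "\<chi> g = 1" if g: "g \<in> carrier G" "\<epsilon> g = 1" for g
    proof -
      obtain a where a: "f g = (a, False)"
        using g by (cases "f g") (auto simp: \<epsilon>_def split: if_splits)
      have "f (t \<otimes> g \<otimes> (t \<otimes> g)) = f \<one>"
        using t g by (simp add: f_mult f_one a dihedral_group_def)
      then have "t \<otimes> g \<otimes> (t \<otimes> g) = \<one>" using f_eqD t g by simp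
      then have "(\<chi> t * \<chi> g) * (\<chi> t * \<chi> g) = 1"
        using t g one by (metis mult m_closed)
      then have sq: "\<chi> g * \<chi> g = 1" using \<chi>t by (simp add: mult_ac)
      obtain k where "n = 2 * k + 1" using n by (elim oddE)
      then have "\<chi> g ^ n = (\<chi> g * \<chi> g) ^ k * \<chi> g"
        by (simp add: power_mult power2_eq_square)
      moreover have "\<chi> g ^ n = 1" using pow[OF g(1), of n] rot[OF g] one by simp
      ultimately show ?thesis using sq by simp
    qed
    have neg: "\<chi> g = \<chi> t" if g: "g \<in> carrier G" "\<epsilon> g = -1" for g
    proof -
      have "\<epsilon> (g \<otimes> t) = 1" using g t by (simp add: sign_mult) (simp add: \<epsilon>_def)
      then have "\<chi> g * \<chi> t = 1" using pos[of "g \<otimes> t"] mult[of g t] g t by simp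
      then show ?thesis using \<chi>t by (metis mult.assoc mult.commute mult_1)
    qed
    have ext: "\<chi> = restrict \<chi> (carrier G)"
      by (auto simp: \<chi>_eq rep_character_def fun_eq_iff)
    consider "\<chi> t = 1" | "\<chi> t = -1" using \<chi>t square_eq_1_iff by blast
    then show ?thesis
    proof cases
      case 1
      then have "\<chi> g = 1" if "g \<in> carrier G" for g
        using sign_cases[OF that] pos[OF that] neg[OF that] by auto
      then show ?thesis using ext by (auto simp: principal_character_def cong: restrict_cong)
    next
      case 2
      then have "\<chi> g = \<epsilon> g" if "g \<in> carrier G" for g
        using sign_cases[OF that] pos[OF that] neg[OF that] by auto
      then show ?thesis using ext by (auto cong: restrict_cong)
    qed
  qed
  then have "linear_characters G = {principal_character G, restrict \<epsilon> (carrier G)}"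
    using principal_linear sign_linear by auto
  then show "Upsilon 2 G = linear_characters G" "card (linear_characters G) = 2"
    using Upsilon_eq_pair[OF odd_ord] sign_not_principal by auto
qed

section \<open>Reflections and determinants\<close>

text \<open>An arbitrary enumeration of the basis; it serves to turn an endomorphism of a Euclidean space,
  whose dimension is given by its type, into a matrix that has a determinant.\<close>

definition basis_list :: "'a::euclidean_space list" where
  "basis_list = (SOME bs. distinct bs \<and> set bs = Basis)"

lemma basis_list: "distinct (basis_list :: 'a::euclidean_space list)"
  "set basis_list = (Basis :: 'a::euclidean_space set)"
proof -
  have "\<exists>bs. distinct bs \<and> set bs = (Basis :: 'a set)"
    using finite_distinct_list[OF finite_Basis] by blast
  then have "distinct (basis_list :: 'a list) \<and> set basis_list = (Basis :: 'a set)"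
    unfolding basis_list_def by (rule someI_ex)
  then show "distinct (basis_list :: 'a list)" "set basis_list = (Basis :: 'a set)" by auto
qed

definition matrix_of :: "('a::euclidean_space \<Rightarrow> 'a) \<Rightarrow> real mat" where
  "matrix_of f = mat DIM('a) DIM('a) (\<lambda>(i, j). inner (f (basis_list ! j)) (basis_list ! i))"

definition linear_det :: "('a::euclidean_space \<Rightarrow> 'a) \<Rightarrow> real" where
  "linear_det f = Determinant.det (matrix_of f)"

lemma length_basis_list: "length (basis_list :: 'a::euclidean_space list) = DIM('a)"
  using distinct_card[OF basis_list(1), where 'a1 = 'a] by (simp add: basis_list(2))

lemma basis_list_nth: "i < DIM('a) \<Longrightarrow> (basis_list ! i :: 'a::euclidean_space) \<in> Basis"
  using nth_mem[of i "basis_list :: 'a list"] by (simp add: basis_list(2) length_basis_list)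

lemma inner_basis_list:
  assumes "i < DIM('a)" "j < DIM('a)"
  shows "inner (basis_list ! i :: 'a::euclidean_space) (basis_list ! j) = (if i = j then 1 else 0)"
  using assms basis_list_nth[of i, where 'a = 'a] basis_list_nth[of j, where 'a = 'a]
  by (simp add: inner_Basis nth_eq_iff_index_eq basis_list length_basis_list)

lemma sum_basis_list: "(\<Sum>i<DIM('a). F (basis_list ! i)) = (\<Sum>b\<in>(Basis :: 'a::euclidean_space set). F b)"
proof -
  have "bij_betw ((!) (basis_list :: 'a list)) {..<DIM('a)} Basis"
    using bij_betw_nth[OF basis_list(1)[where 'a = 'a] _ basis_list(2)[symmetric]]
    by (simp add: length_basis_list)
  then show ?thesis by (rule sum.reindex_bij_betw)
qed

lemma linear_det_compose:
  fixes f g :: "'a::euclidean_space \<Rightarrow> 'a"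
  assumes "linear f" "linear g"
  shows "linear_det (f \<circ> g) = linear_det f * linear_det g"
proof -
  have "matrix_of (f \<circ> g) = matrix_of f * matrix_of g"
  proof (rule eq_matI)
    fix i j assume "i < dim_row (matrix_of f * matrix_of g)" "j < dim_col (matrix_of f * matrix_of g)"
    then have ij: "i < DIM('a)" "j < DIM('a)" by (auto simp: matrix_of_def)
    let ?y = "g (basis_list ! j)"
    have "f ?y = f (\<Sum>b\<in>Basis. inner ?y b *\<^sub>R b)" by (simp add: euclidean_representation)
    also have "\<dots> = (\<Sum>b\<in>Basis. inner ?y b *\<^sub>R f b)"
      using assms(1) by (simp add: linear_sum linear_scale)
    finally have "inner (f ?y) (basis_list ! i) =
        (\<Sum>b\<in>Basis. inner (f b) (basis_list ! i) * inner ?y b)"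
      by (simp add: inner_sum_left mult.commute)
    also have "\<dots> = (\<Sum>k<DIM('a). inner (f (basis_list ! k)) (basis_list ! i) * inner ?y (basis_list ! k))"
      by (rule sum_basis_list[symmetric])
    finally show "matrix_of (f \<circ> g) $$ (i, j) = (matrix_of f * matrix_of g) $$ (i, j)"
      using ij by (simp add: matrix_of_def scalar_prod_def atLeast0LessThan)
  qed (auto simp: matrix_of_def)
  then show ?thesis
    by (simp add: linear_det_def det_mult[of _ "DIM('a)"] matrix_of_def)
qed

lemma linear_det_id: "linear_det (id :: 'a::euclidean_space \<Rightarrow> 'a) = 1"
proof -
  have "matrix_of (id :: 'a \<Rightarrow> 'a) = 1\<^sub>m DIM('a)"
    by (rule eq_matI) (auto simp: matrix_of_def inner_basis_list)
  then show ?thesis by (simp add: linear_det_def)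
qed

lemma linear_reflection: "linear (reflection v)"
  by (rule linearI) (simp_all add: reflection_def inner_add_left distrib_left add_divide_distrib
      scaleR_left_distrib scaleR_right_diff_distrib)

lemma inner_reflection: "inner (reflection v x) (reflection v y) = inner x y"
proof (cases "v = 0")
  case False
  define a b where "a = 2 * inner x v / inner v v" and "b = 2 * inner y v / inner v v"
  have ab: "a * inner v v = 2 * inner x v" "b * inner v v = 2 * inner y v"
    using False by (simp_all add: a_def b_def)
  have "inner (reflection v x) (reflection v y) = inner (x - a *\<^sub>R v) (y - b *\<^sub>R v)"
    by (simp only: reflection_def a_def b_def)
  also have "\<dots> = inner x y - b * inner x v - a * inner y v + a * (b * inner v v)"
    by (simp add: inner_commute algebra_simps)
  also have "b * inner x v = a * inner y v"
    using False by (simp add: a_def b_def)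
  finally show ?thesis by (simp add: ab)
qed (simp add: reflection_def)

lemma orthogonal_transformation_reflection: "orthogonal_transformation (reflection v)"
  by (simp add: orthogonal_transformation_def linear_reflection inner_reflection)

lemma reflection_self: "reflection v v = - v"
  by (cases "v = 0") (auto simp: reflection_def scaleR_2)

lemma reflection_comp_self: "reflection v \<circ> reflection v = id"
proof
  fix x
  have "reflection v (reflection v x) =
      reflection v x - (2 * inner x v / inner v v) *\<^sub>R reflection v v"
    using linear_reflection[of v] by (simp add: reflection_def[of v x] linear_diff linear_scale)
  then show "(reflection v \<circ> reflection v) x = id x"
    unfolding reflection_self by (simp add: reflection_def)
qed

lemma reflection_eq_self_imp: "reflection v x = x \<Longrightarrow> v \<noteq> 0 \<Longrightarrow> inner x v = 0"
  by (auto simp: reflection_def)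

lemma reflection_scaleR: "c \<noteq> 0 \<Longrightarrow> reflection (c *\<^sub>R v) = reflection v"
  by (rule ext) (auto simp: reflection_def)

lemma reflection_conjugate:
  assumes "linear g" "\<And>x y. inner (g x) (g y) = inner x y"
  shows "g \<circ> reflection v = reflection (g v) \<circ> g"
  using assms by (auto simp: fun_eq_iff reflection_def linear_diff linear_scale)

lemma linear_det_reflection_Basis:
  fixes b :: "'a::euclidean_space"
  assumes "b \<in> Basis"
  shows "linear_det (reflection b) = -1"
proof -
  obtain k where k: "k < DIM('a)" "b = basis_list ! k"
    using assms by (auto simp: basis_list(2)[symmetric] in_set_conv_nth length_basis_list)
  have entry: "matrix_of (reflection b) $$ (i, j) = (if i = j then if i = k then -1 else 1 else 0)"
    if "i < DIM('a)" "j < DIM('a)" for i j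
    using that k by (auto simp: matrix_of_def reflection_def inner_diff_left inner_basis_list)
  have M: "matrix_of (reflection b) \<in> carrier_mat DIM('a) DIM('a)" by (simp add: matrix_of_def)
  have "upper_triangular (matrix_of (reflection b))"
    using M by (auto simp: entry)
  then have "linear_det (reflection b) = prod_list (diag_mat (matrix_of (reflection b)))"
    unfolding linear_det_def using M by (rule det_upper_triangular)
  also have "\<dots> = (\<Prod>i<DIM('a). matrix_of (reflection b) $$ (i, i))"
    using M by (simp add: diag_mat_def prod.list_conv_set_nth atLeast0LessThan)
  also have "\<dots> = (\<Prod>i<DIM('a). if i = k then -1 else 1)"
    by (simp add: entry)
  also have "\<dots> = -1" using k by simp
  finally show ?thesis .
qed

text \<open>The unit normal vector is moved to a basis vector by the reflection in their difference, and
  conjugation does not change the determinant.\<close>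

lemma linear_det_reflection:
  fixes v :: "'a::euclidean_space"
  assumes "v \<noteq> 0"
  shows "linear_det (reflection v) = -1"
proof -
  obtain b :: 'a where b: "b \<in> Basis" using nonempty_Basis by blast
  define u where "u = (1 / norm v) *\<^sub>R v"
  have u: "norm u = 1" and ru: "reflection u = reflection v"
    using assms by (auto simp: u_def reflection_scaleR)
  define w where "w = u - b"
  have nb: "inner b b = 1" "inner u u = 1" using b u by (auto simp: dot_square_norm)
  \<comment> \<open>The case \<open>w = 0\<close> needs no separate choice because \<open>reflection 0\<close> is the identity.\<close>
  have "reflection w u = b"
  proof (cases "w = 0")
    case False
    then have "inner w w \<noteq> 0" by simp
    moreover have "2 * inner u w = inner w w"
      using nb by (simp add: w_def inner_diff_left inner_diff_right inner_commute)
    ultimately show ?thesis by (simp add: reflection_def w_def)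
  qed (simp add: reflection_def w_def)
  then have "reflection w \<circ> reflection u = reflection b \<circ> reflection w"
    using reflection_conjugate[OF linear_reflection inner_reflection, of w u] by simp
  then have "linear_det (reflection w) * linear_det (reflection u) =
      linear_det (reflection b) * linear_det (reflection w)"
    by (metis linear_det_compose linear_reflection)
  moreover have "linear_det (reflection w) \<noteq> 0"
    using linear_det_compose[OF linear_reflection linear_reflection, of w w]
    by (auto simp: reflection_comp_self linear_det_id)
  ultimately show ?thesis using linear_det_reflection_Basis[OF b]
    by (metis mult.commute mult_left_cancel ru)
qed

section \<open>Finite reflection groups\<close>

lemma group_orthogonal_group: "group (orthogonal_group :: ('a::euclidean_space \<Rightarrow> 'a) monoid)"
proof (rule groupI)
  fix f :: "'a \<Rightarrow> 'a" assume f: "f \<in> carrier orthogonal_group"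
  then show "\<exists>g\<in>carrier orthogonal_group. g \<otimes>\<^bsub>orthogonal_group\<^esub> f = \<one>\<^bsub>orthogonal_group\<^esub>"
    by (intro bexI[of _ "inv_into UNIV f"])
      (auto simp: orthogonal_group_def orthogonal_transformation_inv orthogonal_transformation_inj)
qed (auto simp: orthogonal_group_def orthogonal_transformation_compose comp_assoc
    orthogonal_transformation_id[folded id_def])

lemma orthogonal_group_mult [simp]: "f \<otimes>\<^bsub>orthogonal_group\<^esub> g = f \<circ> g"
  and orthogonal_group_one [simp]: "\<one>\<^bsub>orthogonal_group\<^esub> = id"
  by (simp_all add: orthogonal_group_def)

text \<open>The group is determined by its roots \<open>V\<close>. It has at least one root, which makes its determinant
  character nontrivial.\<close>

locale reflection_group =
  fixes V :: "'a::euclidean_space set" and G :: "('a \<Rightarrow> 'a) monoid"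
  assumes G_def: "G = subgroup_generated orthogonal_group (reflection ` V)"
    and nonzero: "0 \<notin> V"
    and finite_carrier: "finite (carrier G)"
    and nonempty: "V \<noteq> {}"
begin

lemma group_G: "group G"
  unfolding G_def by (rule group.group_subgroup_generated[OF group_orthogonal_group])

lemma mult_G: "f \<otimes>\<^bsub>G\<^esub> g = f \<circ> g" and one_G: "\<one>\<^bsub>G\<^esub> = id"
  by (simp_all add: G_def)

lemma id_in: "id \<in> carrier G"
  using group.is_monoid[OF group_G] monoid.one_closed one_G by metis

lemma comp_in: "f \<in> carrier G \<Longrightarrow> g \<in> carrier G \<Longrightarrow> f \<circ> g \<in> carrier G"
  using group.is_monoid[OF group_G] monoid.m_closed mult_G by metis

lemma reflection_in: "v \<in> V \<Longrightarrow> reflection v \<in> carrier G"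
  by (auto simp: G_def carrier_subgroup_generated orthogonal_group_def orthogonal_transformation_reflection
      intro!: generate.incl)

text \<open>Reflections are their own inverses, so that no case for inverses is needed.\<close>

lemma carrier_induct [consumes 1, case_names id reflection comp]:
  assumes "g \<in> carrier G" "P id" "\<And>v. v \<in> V \<Longrightarrow> P (reflection v)"
    and "\<And>f g. f \<in> carrier G \<Longrightarrow> g \<in> carrier G \<Longrightarrow> P f \<Longrightarrow> P g \<Longrightarrow> P (f \<circ> g)"
  shows "P g"
proof -
  have "g \<in> generate orthogonal_group (carrier orthogonal_group \<inter> reflection ` V)"
    using assms(1) by (simp add: G_def carrier_subgroup_generated)
  then show ?thesis
  proof induction
    case (inv h)
    then obtain v where v: "v \<in> V" "h = reflection v" by auto
    interpret group orthogonal_group by (rule group_orthogonal_group)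
    have "inv\<^bsub>orthogonal_group\<^esub> h = h"
      using inv by (intro inv_equality) (auto simp: v reflection_comp_self)
    then show ?case using v assms(3) by simp
  next
    case (eng f g)
    then show ?case
      unfolding orthogonal_group_mult
      by (intro assms(4)) (auto simp: G_def carrier_subgroup_generated)
  next
    case one
    show ?case unfolding orthogonal_group_one by (rule assms(2))
  next
    case (incl h)
    then show ?case using assms(3) by auto
  qed
qed

lemma linear_carrier: "g \<in> carrier G \<Longrightarrow> linear g"
  by (erule carrier_induct) (simp_all only: linear_reflection linear_compose linear_id)

lemma inner_carrier: "g \<in> carrier G \<Longrightarrow> inner (g x) (g y) = inner x y"
  by (induction arbitrary: x y rule: carrier_induct) (auto simp: inner_reflection)

lemma inverse_carrier: 
  assumes "g \<in> carrier G"
  obtains h where "h \<in> carrier G" "h \<circ> g = id" "g \<circ> h = id"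
proof -
  interpret group G by (rule group_G)
  show thesis using that[of "inv\<^bsub>G\<^esub> g"] assms l_inv[OF assms] r_inv[OF assms]
    by (simp add: mult_G one_G)
qed

lemma pow_G: "g [^]\<^bsub>G\<^esub> (k::nat) = g ^^ k"
  by (induction k) (simp_all add: mult_G one_G nat_pow_def funpow_swap1 fun_eq_iff)

lemma pow_in: "g \<in> carrier G \<Longrightarrow> g ^^ k \<in> carrier G"
  by (induction k) (auto intro: id_in comp_in)

lemma det_comp:
  "f \<in> carrier G \<Longrightarrow> g \<in> carrier G \<Longrightarrow> linear_det (f \<circ> g) = linear_det f * linear_det g"
  by (simp add: linear_det_compose linear_carrier)

lemma det_cases: "g \<in> carrier G \<Longrightarrow> linear_det g = 1 \<or> linear_det g = -1"
proof (induction rule: carrier_induct)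
  case (reflection v)
  then show ?case using linear_det_reflection[of v] nonzero by auto
next
  case (comp f g)
  then show ?case unfolding det_comp[OF comp.hyps] by auto
qed (simp_all only: linear_det_id simp_thms)

lemma det_reflection: "v \<in> V \<Longrightarrow> linear_det (reflection v) = -1"
  using linear_det_reflection[of v] nonzero by auto

lemma det_pow: "g \<in> carrier G \<Longrightarrow> linear_det (g ^^ k) = linear_det g ^ k"
  by (induction k) (simp_all add: linear_det_id det_comp pow_in)

lemma sign_character: "sign_character G (\<lambda>g. complex_of_real (linear_det g))"
proof -
  interpret group G by (rule group_G)
  obtain v where "v \<in> V" using nonempty by auto
  then have "\<exists>g\<in>carrier G. complex_of_real (linear_det g) = -1"
    by (intro bexI[of _ "reflection v"]) (simp_all add: det_reflection reflection_in)
  moreover have "complex_of_real (linear_det g) = 1 \<or> complex_of_real (linear_det g) = -1"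
    if "g \<in> carrier G" for g
    using det_cases[OF that] by auto
  moreover have "complex_of_real (linear_det (g \<otimes>\<^bsub>G\<^esub> h)) =
      complex_of_real (linear_det g) * complex_of_real (linear_det h)"
    if "g \<in> carrier G" "h \<in> carrier G" for g h
    unfolding mult_G det_comp[OF that] by simp
  ultimately show ?thesis
    by unfold_locales (auto simp: finite_carrier)
qed

lemma carrier_span: "g \<in> carrier G \<Longrightarrow> x \<in> span V \<Longrightarrow> g x \<in> span V"
  by (induction arbitrary: x rule: carrier_induct)
    (auto simp: reflection_def intro!: span_diff span_scale intro: span_base)

lemma carrier_diff_span: "g \<in> carrier G \<Longrightarrow> g x - x \<in> span V"
proof (induction arbitrary: x rule: carrier_induct)
  case (comp f g)
  have "(f (g x) - g x) + (g x - x) \<in> span V" by (intro span_add comp.IH)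
  then show ?case by simp
qed (auto simp: reflection_def span_zero span_neg span_scale span_base)

lemma carrier_fixes: "g \<in> carrier G \<Longrightarrow> (\<And>v. v \<in> V \<Longrightarrow> inner x v = 0) \<Longrightarrow> g x = x"
  by (induction rule: carrier_induct) (auto simp: reflection_def)

end

lemma ord_odd_imp_funpow:
  assumes "reflection_group V G" "g \<in> carrier G" "odd (group.ord G g)"
  shows "\<exists>m. odd m \<and> g ^^ m = id"
proof -
  interpret reflection_group V G by fact
  interpret group G by (rule group_G)
  show ?thesis using pow_ord_eq_1[OF assms(2)] assms(3) by (auto simp: pow_G one_G)
qed

lemma funpow_comp_commute:
  assumes "f \<circ> g = g \<circ> f"
  shows "(f \<circ> g) ^^ k = f ^^ k \<circ> g ^^ k"
proof
  fix a
  have gf: "g (f b) = f (g b)" for b using fun_cong[OF assms, of b] by simp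
  have comm: "g ((f ^^ k) b) = (f ^^ k) (g b)" for b k
    by (induction k) (simp_all add: gf)
  have "((f \<circ> g) ^^ k) a = (f ^^ k) ((g ^^ k) a)"
    by (induction k) (simp_all add: comm)
  then show "((f \<circ> g) ^^ k) a = (f ^^ k \<circ> g ^^ k) a" by simp
qed

lemma odd_funpow_involution:
  assumes "z \<circ> z = id" "odd k"
  shows "z ^^ k = z"
proof -
  obtain j where "k = 2 * j + 1" using assms(2) by (elim oddE)
  moreover have "z ^^ (2 * j) = id"
    using assms(1) by (induction j) (auto simp: fun_eq_iff)
  ultimately show ?thesis by simp
qed

text \<open>For \<open>d = x y\<close> the involution \<open>x\<close> inverts \<open>d\<close>, so that \<open>d\<^sup>k x d\<^sup>-\<^sup>k = d\<^sup>2\<^sup>k x = d\<^sup>-\<^sup>1 x = y\<close>. It is stated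
  without inverses.\<close>

lemma involutions_conjugate:
  assumes x: "x \<circ> x = id" and y: "y \<circ> y = id"
    and odd: "(x \<circ> y) ^^ (2 * k + 1) = id"
  shows "(x \<circ> y) ^^ k \<circ> x = y \<circ> (x \<circ> y) ^^ k"
proof -
  let ?d = "x \<circ> y" and ?e = "y \<circ> x"
  have xx: "x (x a) = a" and yy: "y (y a) = a" for a
    using fun_cong[OF x, of a] fun_cong[OF y, of a] by simp_all
  have swap: "x ((?e ^^ j) a) = (?d ^^ j) (x a)" for j a
    by (induction j) simp_all
  have cancel: "(?e ^^ j) ((?d ^^ j) a) = a" for j a
  proof (induction j)
    case (Suc j)
    have "(?e ^^ Suc j) ((?d ^^ Suc j) a) = (?e ^^ j) (?e (?d ((?d ^^ j) a)))"
      by (simp only: funpow_Suc_right[of j ?e] funpow.simps(2)[of j ?d] o_apply)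
    also have "?e (?d ((?d ^^ j) a)) = (?d ^^ j) a" by (simp add: xx yy)
    also have "(?e ^^ j) ((?d ^^ j) a) = a" by (rule Suc.IH)
    finally show ?case .
  qed simp
  show ?thesis
  proof
    fix a
    have "(?d ^^ k) (?d ((?d ^^ k) a)) = (?d ^^ (k + Suc k)) a"
      by (simp only: funpow_add funpow.simps(2) o_apply)
    also have "\<dots> = a" using fun_cong[OF odd, of a] by (simp add: mult_2)
    finally have "?d ((?d ^^ k) a) = (?e ^^ k) a"
      using cancel[of k "?d ((?d ^^ k) a)"] by simp
    then have "y ((?d ^^ k) a) = x ((?e ^^ k) a)" using xx by (metis o_apply)
    then show "(?d ^^ k \<circ> x) a = (y \<circ> ?d ^^ k) a" by (simp add: swap)
  qed
qed

section \<open>Reflection groups whose rotations have odd order\<close>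

text \<open>Reflection groups in which the rotations, the elements of determinant \<open>1\<close>, have odd order. Oddness of the order is expressed by
  iteration of functions and not by the order in a group, so that it passes to subgroups at once.\<close>

locale odd_reflection_group = reflection_group +
  assumes odd_rotation: "\<And>g. g \<in> carrier G \<Longrightarrow> linear_det g = 1 \<Longrightarrow> \<exists>m. odd m \<and> g ^^ m = id"
begin

definition involutions :: "('a \<Rightarrow> 'a) set" where
  "involutions = {z \<in> carrier G. z \<circ> z = id \<and> z \<noteq> id}"

definition rotation_centralizer :: "('a \<Rightarrow> 'a) \<Rightarrow> ('a \<Rightarrow> 'a) set" where
  "rotation_centralizer z = {h \<in> carrier G. linear_det h = 1 \<and> h \<circ> z = z \<circ> h}"

lemma involution_det: "z \<in> involutions \<Longrightarrow> linear_det z = -1"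
  using det_cases[of z] odd_rotation[of z] odd_funpow_involution[of z]
  by (auto simp: involutions_def)

lemma reflection_involution: "v \<in> V \<Longrightarrow> reflection v \<in> involutions"
  using det_reflection[of v] linear_det_id[where 'a = 'a]
  by (auto simp: involutions_def reflection_in reflection_comp_self)

lemma involutions_conj:
  assumes "x \<in> involutions" "y \<in> involutions"
  obtains c where "c \<in> carrier G" "c \<circ> x = y \<circ> c"
proof -
  have xy: "x \<in> carrier G" "y \<in> carrier G" using assms by (auto simp: involutions_def)
  have "linear_det (x \<circ> y) = 1"
    using assms xy by (simp only: det_comp involution_det)
  then obtain m where "odd m" and m: "(x \<circ> y) ^^ m = id"
    using odd_rotation[OF comp_in[OF xy]] by auto
  from \<open>odd m\<close> obtain k where "m = 2 * k + 1" by (elim oddE)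
  with m have "(x \<circ> y) ^^ k \<circ> x = y \<circ> (x \<circ> y) ^^ k"
    using assms by (intro involutions_conjugate) (auto simp: involutions_def)
  then show thesis using that[OF pow_in[OF comp_in[OF xy]]] by blast
qed

lemma carrier_eq_0_iff: "g \<in> carrier G \<Longrightarrow> g x = 0 \<longleftrightarrow> x = 0"
  using inner_carrier[of g x x] by (metis inner_eq_zero_iff)

text \<open>All involutions are conjugate to the reflection in one root, and a conjugate of a reflection by an
  isometry is a reflection.\<close>

lemma involution_is_reflection:
  assumes "z \<in> involutions"
  shows "\<exists>v. v \<noteq> 0 \<and> z = reflection v"
proof -
  obtain v where v: "v \<in> V" using nonempty by auto
  obtain c where c: "c \<in> carrier G" "c \<circ> reflection v = z \<circ> c"
    using involutions_conj[OF reflection_involution[OF v] assms] .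
  obtain d where d: "c \<circ> d = id" using inverse_carrier[OF c(1)] by metis
  have "c \<circ> reflection v = reflection (c v) \<circ> c"
    by (intro reflection_conjugate linear_carrier inner_carrier c)
  then have "z \<circ> c = reflection (c v) \<circ> c" using c by simp
  then have "z \<circ> (c \<circ> d) = reflection (c v) \<circ> (c \<circ> d)" by (simp add: comp_assoc[symmetric])
  then have "z = reflection (c v)" using d by simp
  moreover have "c v \<noteq> 0" using carrier_eq_0_iff[OF c(1)] v nonzero by auto
  ultimately show ?thesis by blast
qed

definition root_of :: "('a \<Rightarrow> 'a) \<Rightarrow> 'a" where
  "root_of z = (SOME v. v \<noteq> 0 \<and> z = reflection v)"

lemma root_of:
  assumes "z \<in> involutions"
  shows "root_of z \<noteq> 0" "reflection (root_of z) = z"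
proof -
  have "root_of z \<noteq> 0 \<and> z = reflection (root_of z)"
    unfolding root_of_def by (rule someI_ex[OF involution_is_reflection[OF assms]])
  then show "root_of z \<noteq> 0" "reflection (root_of z) = z" by simp_all
qed

lemma root_span: "z \<in> involutions \<Longrightarrow> root_of z \<in> span V"
proof -
  assume z: "z \<in> involutions"
  have "z (root_of z) = - root_of z" using root_of[OF z] reflection_self[of "root_of z"] by simp
  moreover have "z (root_of z) - root_of z \<in> span V"
    using z by (intro carrier_diff_span) (auto simp: involutions_def)
  ultimately have "(-1/2) *\<^sub>R (- root_of z - root_of z) \<in> span V" by (metis span_scale)
  then show ?thesis by (simp add: algebra_simps flip: scaleR_2)
qed

text \<open>An isometry has only the real eigenvalues \<open>1\<close> and \<open>-1\<close>, and \<open>-1\<close> is excluded by the odd order.\<close>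

lemma rotation_fixes_eigenvector:
  assumes h: "h \<in> carrier G" "linear_det h = 1" and u: "h u = c *\<^sub>R u"
  shows "h u = u"
proof (cases "u = 0")
  case True
  then show ?thesis using carrier_eq_0_iff[OF h(1)] by simp
next
  case False
  obtain m where m: "odd m" "h ^^ m = id" using odd_rotation[OF h] by auto
  have "(h ^^ k) u = c ^ k *\<^sub>R u" for k
    by (induction k) (simp_all add: u linear_scale[OF linear_carrier[OF h(1)]])
  then have "c ^ m *\<^sub>R u = u" using m(2) by (metis id_apply)
  then have "c ^ m = 1" using False by (metis scaleR_one scaleR_right_imp_eq)
  have "inner (c *\<^sub>R u) (c *\<^sub>R u) = inner u u" using inner_carrier[OF h(1), of u u] u by simp
  then have "c * c = 1" using False by (simp add: power2_eq_square)
  then have "c = 1 \<or> c = -1" using square_eq_1_iff by blast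
  then have "c = 1" using \<open>c ^ m = 1\<close> m(1) by (auto simp: minus_one_power_iff)
  then show ?thesis using u by simp
qed

lemma rotation_centralizer_fixes_root:
  assumes z: "z \<in> involutions" and h: "h \<in> rotation_centralizer z"
  shows "h (root_of z) = root_of z"
proof -
  define v where "v = root_of z"
  have v: "v \<noteq> 0" "z = reflection v" using root_of[OF z] by (auto simp: v_def)
  have hG: "h \<in> carrier G" "linear_det h = 1" and comm: "h (z v) = z (h v)"
    using h by (auto simp: rotation_centralizer_def fun_eq_iff)
  have "z (h v) = - h v"
    using comm linear_neg[OF linear_carrier[OF hG(1)]] by (simp add: v(2) reflection_self)
  then have "2 *\<^sub>R h v = (2 * inner (h v) v / inner v v) *\<^sub>R v"
    by (simp add: v(2) reflection_def scaleR_2 algebra_simps)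
  then have "(1/2) *\<^sub>R (2 *\<^sub>R h v) = (1/2) *\<^sub>R ((2 * inner (h v) v / inner v v) *\<^sub>R v)" by simp
  then have "h v = (inner (h v) v / inner v v) *\<^sub>R v" by simp
  from rotation_fixes_eigenvector[OF hG this] show ?thesis by (simp only: v_def)
qed

lemma finite_involutions: "finite involutions" and finite_rotation_centralizer: "finite (rotation_centralizer z)"
  using finite_carrier by (simp_all add: involutions_def rotation_centralizer_def)

text \<open>An element of determinant \<open>-1\<close> is in a unique way the product of an involution
  and of an element of odd order that commutes with it: its \<open>2\<close>-part and its \<open>2'\<close>-part.\<close>

lemma bij_betw_negative:
  "bij_betw (\<lambda>(z, h). z \<circ> h) (SIGMA z:involutions. rotation_centralizer z) {g \<in> carrier G. linear_det g = -1}"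
  (is "bij_betw ?f ?A ?B")
proof (rule bij_betw_imageI)
  show "inj_on ?f ?A"
  proof (rule inj_onI, clarify)
    fix z h z' h'
    assume z: "z \<in> involutions" "z' \<in> involutions" and h: "h \<in> rotation_centralizer z" "h' \<in> rotation_centralizer z'"
      and eq: "z \<circ> h = z' \<circ> h'"
    obtain m where m: "odd m" "h ^^ m = id" using odd_rotation[of h] h by (auto simp: rotation_centralizer_def)
    obtain m' where m': "odd m'" "h' ^^ m' = id" using odd_rotation[of h'] h by (auto simp: rotation_centralizer_def)
    \<comment> \<open>This odd exponent removes \<open>h\<close> and \<open>h'\<close> from the products and keeps the involutions.\<close>
    let ?k = "m * m'"
    have k: "odd ?k" "h ^^ ?k = id" "h' ^^ ?k = id"
      using m m' by (auto simp: funpow_mult[symmetric]) (metis funpow_mult id_funpow mult.commute)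
    have "z = (z \<circ> h) ^^ ?k"
      using z h k by (subst funpow_comp_commute)
        (auto simp: rotation_centralizer_def involutions_def odd_funpow_involution)
    also have "\<dots> = z'"
      unfolding eq using z h k by (subst funpow_comp_commute)
        (auto simp: rotation_centralizer_def involutions_def odd_funpow_involution)
    finally have zz': "z = z'" .
    have "z \<circ> (z \<circ> h) = z \<circ> (z \<circ> h')" using eq zz' by simp
    then have "h = h'" using z by (simp add: comp_assoc[symmetric] involutions_def)
    with zz' show "z = z' \<and> h = h'" by simp
  qed
  show "?f ` ?A = ?B"
  proof (intro equalityI subsetI)
    fix g assume "g \<in> ?f ` ?A"
    then obtain z h where g: "g = z \<circ> h" "z \<in> involutions" "h \<in> rotation_centralizer z" by auto
    then have "z \<in> carrier G" "h \<in> carrier G" "linear_det h = 1"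
      by (auto simp: involutions_def rotation_centralizer_def)
    then show "g \<in> ?B"
      using involution_det[OF g(2)] by (simp only: g(1) comp_in det_comp mem_Collect_eq) simp
  next
    fix g assume "g \<in> ?B"
    then have g: "g \<in> carrier G" "linear_det g = -1" by auto
    \<comment> \<open>If \<open>g\<^sup>2\<close> has odd order \<open>m\<close>, then \<open>g = g\<^sup>m g\<^sup>m\<^sup>+\<^sup>1\<close>, where \<open>m + 1\<close> is even.\<close>
    have "linear_det (g \<circ> g) = 1" using g by (simp only: det_comp)
    then obtain m where m: "odd m" "(g \<circ> g) ^^ m = id"
      using odd_rotation[OF comp_in[OF g(1) g(1)]] by auto
    then have m2: "g ^^ m \<circ> g ^^ m = id" by (simp only: funpow_comp_commute)
    have det: "linear_det (g ^^ m) = -1"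
      using det_pow[OF g(1), of m] g(2) m(1) by simp
    then have "g ^^ m \<noteq> id" using linear_det_id[where 'a = 'a] by auto
    then have "g ^^ m \<in> involutions" using m2 g pow_in by (simp add: involutions_def)
    moreover have "g ^^ Suc m \<in> rotation_centralizer (g ^^ m)"
    proof -
      have "linear_det (g ^^ Suc m) = 1"
        using det_pow[OF g(1), of "Suc m"] g(2) m(1) by simp
      moreover have "g ^^ Suc m \<circ> g ^^ m = g ^^ m \<circ> g ^^ Suc m"
        by (simp only: funpow_add[symmetric] add.commute)
      ultimately show ?thesis using pow_in[OF g(1)] by (simp only: rotation_centralizer_def mem_Collect_eq simp_thms)
    qed
    moreover have "g = g ^^ m \<circ> g ^^ Suc m"
    proof -
      have "g ^^ m \<circ> g ^^ Suc m = (g ^^ m \<circ> g ^^ m) \<circ> g"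
        by (simp only: funpow_Suc_right comp_assoc)
      then show ?thesis using m2 by simp
    qed
    ultimately show "g \<in> ?f ` ?A" by (auto intro!: image_eqI[of _ _ "(g ^^ m, g ^^ Suc m)"])
  qed
qed

end

section \<open>The roots do not span a space of dimension three\<close>

text \<open>Parseval's identity.\<close>

lemma sum_inner_orthonormal_basis:
  fixes B :: "'a::euclidean_space set"
  assumes orth: "pairwise Linear_Algebra.orthogonal B" and norm: "\<And>b. b \<in> B \<Longrightarrow> norm b = 1"
    and fin: "finite B" and x: "x \<in> span B"
  shows "(\<Sum>b\<in>B. (inner b x)\<^sup>2) = inner x x"
proof -
  have bb: "inner b c = (if b = c then 1 else 0)" if "b \<in> B" "c \<in> B" for b c
    using that orth norm[of b] by (auto simp: pairwise_def Linear_Algebra.orthogonal_def norm_eq_1)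
  obtain u where u: "x = (\<Sum>b\<in>B. u b *\<^sub>R b)" using x span_finite[OF fin] by auto
  have "inner b x = u b" if "b \<in> B" for b
  proof -
    have "inner b x = (\<Sum>c\<in>B. if b = c then u c else 0)"
      unfolding u inner_sum_right using that by (intro sum.cong refl) (auto simp: bb)
    then show ?thesis using that fin by simp
  qed
  moreover from this have "inner x x = (\<Sum>b\<in>B. u b * u b)"
    by (subst u) (simp add: inner_sum_left)
  ultimately show ?thesis by (simp add: power2_eq_square)
qed

context odd_reflection_group
begin

lemma carrier_sum: "f \<in> carrier G \<Longrightarrow> f (\<Sum>i\<in>I. F i) = (\<Sum>i\<in>I. f (F i))"
  by (rule linear_sum[OF linear_carrier])

text \<open>Let \<open>p\<close> and \<open>q\<close> be the sums of \<open>g x\<close> over the elements of determinant \<open>1\<close> and \<open>-1\<close>. Every root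
  reflection exchanges them. So it fixes \<open>p + q\<close>, which is therefore orthogonal to all roots and
  must vanish. It also negates \<open>q\<close>, so that all roots would be multiples of \<open>q\<close> if \<open>q\<close> were not \<open>0\<close>.\<close>

lemma sum_negative_eq_0:
  assumes dim: "dim V \<ge> 2" and x: "x \<in> span V"
  shows "(\<Sum>g | g \<in> carrier G \<and> linear_det g = -1. g x) = 0"
proof -
  define P where "P = {g \<in> carrier G. linear_det g = 1}"
  define N where "N = {g \<in> carrier G. linear_det g = -1}"
  define p where "p = (\<Sum>g\<in>P. g x)"
  define q where "q = (\<Sum>g\<in>N. g x)"
  have in_span: "p \<in> span V" "q \<in> span V"
    unfolding p_def q_def using carrier_span[OF _ x] by (auto intro!: span_sum simp: P_def N_def)
  have "reflection v p = q" and "reflection v q = p" if v: "v \<in> V" for v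
  proof -
    note r = reflection_in[OF v]
    have rr: "reflection v (reflection v y) = y" for y
      using fun_cong[OF reflection_comp_self[of v], of y] by simp
    have rr': "reflection v \<circ> (reflection v \<circ> g) = g" for g :: "'a \<Rightarrow> 'a"
      by (simp only: comp_assoc[symmetric] reflection_comp_self id_comp)
    have det: "linear_det (reflection v \<circ> g) = - linear_det g" if "g \<in> carrier G" for g
      using det_comp[OF r that] det_reflection[OF v] by simp
    have "reflection v p = (\<Sum>g\<in>P. (reflection v \<circ> g) x)"
      unfolding p_def carrier_sum[OF r] o_apply by (rule refl)
    also have "\<dots> = q"
      unfolding q_def
      by (rule sum.reindex_bij_witness[where i = "\<lambda>g. reflection v \<circ> g" and j = "\<lambda>g. reflection v \<circ> g"])
        (simp_all only: P_def N_def rr' det comp_in[OF r] mem_Collect_eq simp_thms minus_minus)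
    finally show pq: "reflection v p = q" .
    then show "reflection v q = p" using rr[of p] by simp
  qed
  note swap = this
  have "inner (p + q) v = 0" if "v \<in> V" for v
  proof -
    have "reflection v (p + q) = p + q"
      using swap[OF that] by (simp add: linear_add[OF linear_reflection] add.commute)
    then show ?thesis using that nonzero by (intro reflection_eq_self_imp) auto
  qed
  then have orth: "Linear_Algebra.orthogonal (p + q) v" if "v \<in> V" for v
    using that by (simp add: Linear_Algebra.orthogonal_def)
  have "Linear_Algebra.orthogonal (p + q) y" if "y \<in> span V" for y
    by (rule orthogonal_to_span[OF that]) (rule orth)
  then have "inner (p + q) (p + q) = 0" using span_add[OF in_span] by (simp add: Linear_Algebra.orthogonal_def)
  then have pq: "p = - q" by (simp only: inner_eq_zero_iff eq_neg_iff_add_eq_0)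
  have "q = 0"
  proof (rule ccontr)
    assume "q \<noteq> 0"
    have "v \<in> span {q}" if v: "v \<in> V" for v
    proof -
      have "reflection v q = - q" using swap(2)[OF v] pq by simp
      define c where "c = inner q v / inner v v"
      have "q + q = q - reflection v q" by (simp only: \<open>reflection v q = - q\<close> diff_minus_eq_add)
      also have "\<dots> = (2 * inner q v / inner v v) *\<^sub>R v" by (simp add: reflection_def)
      also have "2 * inner q v / inner v v = 2 * c" by (simp add: c_def)
      finally have double: "q + q = (2 * c) *\<^sub>R v" .
      have "q = (1/2) *\<^sub>R ((2 * c) *\<^sub>R v)"
        unfolding double[symmetric] by (rule scaleR_half_double[symmetric])
      then have qc: "q = c *\<^sub>R v" by simp
      have "c \<noteq> 0"
      proof
        assume "c = 0"
        with qc have "q = 0" by simp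
        with \<open>q \<noteq> 0\<close> show False ..
      qed
      have "v = (1 / c) *\<^sub>R q" unfolding qc scaleR_scaleR using \<open>c \<noteq> 0\<close> by simp
      then show ?thesis using span_scale[OF span_base[of q "{q}"], of "1 / c"] by simp
    qed
    then have "span V \<subseteq> span {q}" by (intro span_minimal) auto
    then have "dim V \<le> dim {q}" using dim_subset[of "span V" "span {q}"] by (simp only: dim_span)
    also have "dim {q} \<le> card {q}" by (rule dim_le_card') simp
    finally show False using dim by simp
  qed
  then show ?thesis by (simp add: q_def N_def)
qed

lemma rotation_centralizer_comp: "h \<in> rotation_centralizer z \<Longrightarrow> k \<in> rotation_centralizer z \<Longrightarrow> h \<circ> k \<in> rotation_centralizer z"
proof -
  assume hk: "h \<in> rotation_centralizer z" "k \<in> rotation_centralizer z"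
  then have "h \<circ> k \<circ> z = z \<circ> (h \<circ> k)"
    by (simp add: rotation_centralizer_def fun_eq_iff)
  then show ?thesis using hk by (simp add: rotation_centralizer_def comp_in det_comp)
qed

lemma rotation_centralizer_inverse:
  assumes "h \<in> rotation_centralizer z"
  obtains k where "k \<in> rotation_centralizer z" "k \<circ> h = id" "h \<circ> k = id"
proof -
  have h: "h \<in> carrier G" "linear_det h = 1" "h \<circ> z = z \<circ> h" using assms by (auto simp: rotation_centralizer_def)
  obtain k where k: "k \<in> carrier G" "k \<circ> h = id" "h \<circ> k = id"
    using inverse_carrier[OF h(1)] by metis
  have "linear_det k = 1"
    using det_comp[OF k(1) h(1)] by (simp add: k h linear_det_id)
  moreover have "k \<circ> z = z \<circ> k"
    using k h by (metis comp_assoc comp_id id_comp)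
  ultimately show thesis using that k by (simp add: rotation_centralizer_def)
qed

lemma id_in_rotation_centralizer: "id \<in> rotation_centralizer z"
  by (simp add: rotation_centralizer_def id_in linear_det_id)

text \<open>In dimension three, a rotation that fixes \<open>y\<close> besides its axis acts on the remaining line by a
  scalar, which is \<open>1\<close> because the order is odd. So it is the identity.\<close>

lemma rotation_centralizer_fixed_space:
  assumes dim: "dim V = 3" and z: "z \<in> involutions" and h: "h \<in> rotation_centralizer z" "h \<noteq> id"
    and y: "y \<in> span V" "h y = y"
  shows "y \<in> span {root_of z}"
proof (rule ccontr)
  assume y_notin: "y \<notin> span {root_of z}"
  have hG: "h \<in> carrier G" "linear_det h = 1" using h by (auto simp: rotation_centralizer_def)
  define v where "v = root_of z"
  have v: "v \<noteq> 0" "v \<in> span V" "h v = v"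
    using root_of[OF z] root_span[OF z] rotation_centralizer_fixes_root[OF z h(1)] by (auto simp: v_def)
  have vy: "{v, y} \<subseteq> span V" using v y by simp
  have "dim {v, y} \<le> card {v, y}" by (rule dim_le_card') simp
  also have "\<dots> \<le> 2" by (simp add: card_insert_if)
  finally have "dim {v, y} < dim V" using dim by simp
  then have "span {v, y} \<noteq> span V" by (metis dim_span less_irrefl)
  moreover have "span {v, y} \<subseteq> span V" using vy by (intro span_minimal) auto
  ultimately have "span {v, y} \<subset> span V" by blast
  then obtain u where u: "u \<noteq> 0" "u \<in> span V" "\<And>w. w \<in> span {v, y} \<Longrightarrow> Linear_Algebra.orthogonal u w"
  proof (rule orthogonal_to_subspace_exists_gen)
    fix u assume "u \<noteq> 0" "u \<in> span V" "\<And>w. w \<in> span {v, y} \<Longrightarrow> Linear_Algebra.orthogonal u w"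
    then show thesis by (rule that)
  qed
  have uv: "inner u v = 0" "inner u y = 0"
    using u(3)[of v] u(3)[of y] by (auto simp: Linear_Algebra.orthogonal_def span_base)
  have "u \<notin> span {v, y}"
    using u(1) u(3)[of u] by (auto simp: Linear_Algebra.orthogonal_def)
  moreover have "independent {v, y}"
    using independent_insertI[of y "{v}"] y_notin v(1) by (simp add: v_def insert_commute)
  ultimately have ind: "independent {u, v, y}"
    by (rule independent_insertI)
  have "u \<notin> {v, y}" "v \<noteq> y"
    using \<open>u \<notin> span {v, y}\<close> y_notin span_base[of u "{v, y}"] span_base[of y "{v}"]
    by (auto simp: v_def)
  then have "card {u, v, y} = 3" by simp
  then have card: "dim (span V) \<le> card {u, v, y}" using dim by (simp only: dim_span)
  have "{u, v, y} \<subseteq> span V" using u(2) vy by auto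
  then have spans: "span V \<subseteq> span {u, v, y}"
    using ind card by (rule card_ge_dim_independent)
  have fix_perp: "span V \<subseteq> {x. h x = x}"
  proof -
    define c where "c = inner (h u) u / inner u u"
    define w where "w = h u - c *\<^sub>R u"
    have "inner (h u) v = 0" "inner (h u) y = 0"
      using inner_carrier[OF hG(1), of u v] inner_carrier[OF hG(1), of u y] uv v(3) y(2) by auto
    moreover have "c * inner u u = inner (h u) u" using u(1) by (simp add: c_def)
    ultimately have orth: "Linear_Algebra.orthogonal w b" if "b \<in> {u, v, y}" for b
      using that uv by (auto simp: w_def Linear_Algebra.orthogonal_def inner_diff_left)
    have "w \<in> span V"
      unfolding w_def by (rule span_diff[OF carrier_span[OF hG(1) u(2)] span_scale[OF u(2)]])
    then have "w \<in> span {u, v, y}" using spans by (rule subsetD[rotated])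
    then have "Linear_Algebra.orthogonal w w" by (rule orthogonal_to_span) (rule orth)
    then have "w = 0" by (simp add: orthogonal_self)
    then have "h u = c *\<^sub>R u" by (simp only: w_def right_minus_eq)
    then have "h u = u" by (rule rotation_fixes_eigenvector[OF hG])
    then have basis: "{u, v, y} \<subseteq> {x. h x = x}" using v(3) y(2) by simp
    have "Real_Vector_Spaces.subspace {x. h x = x}"
      using linear_0[OF linear_carrier[OF hG(1)]] linear_add[OF linear_carrier[OF hG(1)]]
        linear_scale[OF linear_carrier[OF hG(1)]]
      by (simp add: Real_Vector_Spaces.subspace_def)
    with basis have "span {u, v, y} \<subseteq> {x. h x = x}" by (rule span_minimal)
    with spans show ?thesis by (rule subset_trans)
  qed
  have "h = id"
  proof
    fix x
    obtain a b where ab: "a \<in> span V" "\<And>w. w \<in> span V \<Longrightarrow> Linear_Algebra.orthogonal b w" "x = a + b"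
    proof (rule orthogonal_subspace_decomp_exists[of V x])
      fix a b assume "a \<in> span V" "\<And>w. w \<in> span V \<Longrightarrow> Linear_Algebra.orthogonal b w" "x = a + b"
      then show thesis by (rule that)
    qed
    have "inner b w = 0" if "w \<in> V" for w
      using ab(2)[OF span_base[OF that]] by (simp only: Linear_Algebra.orthogonal_def)
    then have "h b = b" by (rule carrier_fixes[OF hG(1)])
    have "h x = h a + h b" by (simp only: ab(3) linear_add[OF linear_carrier[OF hG(1)]])
    also have "h a = a" using subsetD[OF fix_perp ab(1)] by (rule CollectD)
    also have "a + h b = x" by (simp only: \<open>h b = b\<close> ab(3))
    finally show "h x = id x" by (simp only: id_apply)
  qed
  with h(2) show False by contradiction
qed

end

context odd_reflection_group
begin

text \<open>A nontrivial centralizer projects the span of the roots onto its common axis, up to the factor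
  \<open>|rotation_centralizer z|\<close>.\<close>

lemma sum_rotation_centralizer:
  assumes dim: "dim V = 3" and z: "z \<in> involutions" and nontriv: "rotation_centralizer z \<noteq> {id}"
    and x: "x \<in> span V"
  shows "(\<Sum>h\<in>rotation_centralizer z. h x) =
    (of_nat (card (rotation_centralizer z)) * inner x (root_of z) / inner (root_of z) (root_of z)) *\<^sub>R root_of z"
proof -
  define v where "v = root_of z"
  define y where "y = (\<Sum>h\<in>rotation_centralizer z. h x)"
  have v: "inner v v \<noteq> 0" using root_of[OF z] by (simp add: v_def)
  have cG: "h \<in> carrier G" if "h \<in> rotation_centralizer z" for h using that by (simp add: rotation_centralizer_def)
  obtain k where k: "k \<in> rotation_centralizer z" "k \<noteq> id" using nontriv id_in_rotation_centralizer by blast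
  obtain l where l: "l \<in> rotation_centralizer z" "l \<circ> k = id" "k \<circ> l = id" using rotation_centralizer_inverse[OF k(1)] .
  have "k y = (\<Sum>h\<in>rotation_centralizer z. (k \<circ> h) x)"
    unfolding y_def carrier_sum[OF cG[OF k(1)]] o_apply by (rule refl)
  also have "\<dots> = y"
    unfolding y_def
    by (rule sum.reindex_bij_witness[where i = "\<lambda>h. l \<circ> h" and j = "\<lambda>h. k \<circ> h"])
      (simp_all only: comp_assoc[symmetric] l id_comp rotation_centralizer_comp[OF l(1)] rotation_centralizer_comp[OF k(1)])
  finally have fixed: "k y = y" .
  have "y \<in> span V"
    unfolding y_def by (rule span_sum) (rule carrier_span[OF cG x])
  then have "y \<in> span {v}"
    unfolding v_def using fixed by (rule rotation_centralizer_fixed_space[OF dim z k])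
  then obtain t where t: "y = t *\<^sub>R v" by (auto simp: span_singleton)
  have "inner (h x) v = inner x v" if "h \<in> rotation_centralizer z" for h
    using inner_carrier[OF cG[OF that], of x v] rotation_centralizer_fixes_root[OF z that] by (simp add: v_def)
  then have "inner y v = of_nat (card (rotation_centralizer z)) * inner x v"
    by (simp add: y_def inner_sum_left)
  then have "t = of_nat (card (rotation_centralizer z)) * inner x v / inner v v"
    using v by (simp add: t field_simps)
  then show ?thesis using t by (simp only: y_def v_def)
qed

lemma rotation_centralizer_trivial_uniform:
  assumes z: "z \<in> involutions" "z' \<in> involutions" and triv: "rotation_centralizer z = {id}"
  shows "rotation_centralizer z' = {id}"
proof -
  obtain c where c: "c \<in> carrier G" "c \<circ> z = z' \<circ> c" using involutions_conj[OF z] .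
  obtain d where d: "d \<in> carrier G" "d \<circ> c = id" "c \<circ> d = id" using inverse_carrier[OF c(1)] by metis
  have cd: "c (d a) = a" and dc: "d (c a) = a" and cz: "c (z a) = z' (c a)" for a
    using fun_cong[OF d(3), of a] fun_cong[OF d(2), of a] fun_cong[OF c(2), of a] by simp_all
  have dz: "d (z' a) = z (d a)" for a
    using cz[of "d a"] dc[of "z (d a)"] by (simp add: cd)
  have "h = id" if h: "h \<in> rotation_centralizer z'" for h
  proof -
    have hG: "h \<in> carrier G" "linear_det h = 1" and hz: "h (z' a) = z' (h a)" for a
      using h by (auto simp: rotation_centralizer_def fun_eq_iff)
    have "linear_det (d \<circ> (h \<circ> c)) = linear_det (d \<circ> c)"
      by (simp only: det_comp[OF d(1) comp_in[OF hG(1) c(1)]] det_comp[OF hG(1) c(1)]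
          det_comp[OF d(1) c(1)] hG(2) mult_1)
    moreover have "(d \<circ> (h \<circ> c)) \<circ> z = z \<circ> (d \<circ> (h \<circ> c))"
      by (rule ext) (simp only: o_apply cz hz dz)
    ultimately have "d \<circ> (h \<circ> c) \<in> rotation_centralizer z"
      using comp_in[OF d(1) comp_in[OF hG(1) c(1)]]
      by (simp only: rotation_centralizer_def mem_Collect_eq d(2) linear_det_id simp_thms)
    then have eq: "d \<circ> (h \<circ> c) = id" using triv by blast
    show "h = id"
    proof
      fix a
      have "d (h (c (d a))) = d a" using fun_cong[OF eq, of "d a"] by simp
      then have "c (d (h a)) = c (d a)" by (simp only: cd)
      then show "h a = id a" by (simp only: cd id_apply)
    qed
  qed
  then show ?thesis using id_in_rotation_centralizer by blast
qed

lemma sum_over_involutions_eq_0: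
  assumes "dim V \<ge> 2" "x \<in> span V"
  shows "(\<Sum>z\<in>involutions. z (\<Sum>h\<in>rotation_centralizer z. h x)) = 0"
proof -
  have "(\<Sum>z\<in>involutions. z (\<Sum>h\<in>rotation_centralizer z. h x)) = (\<Sum>z\<in>involutions. \<Sum>h\<in>rotation_centralizer z. z (h x))"
    by (intro sum.cong refl carrier_sum) (simp add: involutions_def)
  also have "\<dots> = (\<Sum>(z, h)\<in>(SIGMA z:involutions. rotation_centralizer z). (z \<circ> h) x)"
    by (simp add: sum.Sigma finite_involutions finite_rotation_centralizer)
  also have "\<dots> = (\<Sum>p\<in>(SIGMA z:involutions. rotation_centralizer z). (\<lambda>g. g x) ((\<lambda>(z, h). z \<circ> h) p))"
    by (simp add: case_prod_beta)
  also have "\<dots> = (\<Sum>g\<in>{g \<in> carrier G. linear_det g = -1}. g x)"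
    by (rule sum.reindex_bij_betw[OF bij_betw_negative])
  also have "\<dots> = 0" by (rule sum_negative_eq_0[OF assms])
  finally show ?thesis .
qed

text \<open>Split the sum over the elements of determinant \<open>-1\<close> according to their involutions \<open>z\<close>. If the
  centralizers are trivial, it is \<open>\<Sum>z. z\<close>, whose trace on the span of the roots is the number of
  involutions, since each reflection has trace \<open>1\<close> in dimension three. Otherwise it is minus a
  positive combination of the projections onto the roots. Neither can vanish.\<close>

theorem dim_roots_neq_3: "dim V \<noteq> 3"
proof
  assume dim: "dim V = 3"
  then have dim2: "dim V \<ge> 2" by simp
  obtain v0 where "v0 \<in> V" using nonempty by auto
  then have z0: "reflection v0 \<in> involutions" (is "?z0 \<in> _") by (rule reflection_involution)
  have act: "inner x (z x) = inner x x - 2 * (inner x (root_of z))\<^sup>2 / inner (root_of z) (root_of z)"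
    if z: "z \<in> involutions" for x z
  proof -
    have "z x = reflection (root_of z) x" by (simp only: root_of(2)[OF z])
    then show ?thesis
      by (simp add: reflection_def inner_diff_right power2_eq_square)
  qed
  show False
  proof (cases "rotation_centralizer ?z0 = {id}")
    case True
    have triv: "rotation_centralizer z = {id}" if "z \<in> involutions" for z
      by (rule rotation_centralizer_trivial_uniform[OF z0 that True])
    obtain B where B: "B \<subseteq> span V" "pairwise Linear_Algebra.orthogonal B" "\<And>b. b \<in> B \<Longrightarrow> norm b = 1"
      "independent B" "card B = dim (span V)" "span B = span V"
      using orthonormal_basis_subspace[OF subspace_span[of V]] by metis
    have finB: "finite B" and cardB: "card B = 3"
      using B(4,5) dim independent_imp_finite by simp_all
    \<comment> \<open>The trace of \<open>\<Sum>z. z\<close> is computed in an orthonormal basis of the span of the roots.\<close>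
    have zero: "(\<Sum>z\<in>involutions. inner b (z b)) = 0" if b: "b \<in> B" for b
    proof -
      have "0 = (\<Sum>z\<in>involutions. z (\<Sum>h\<in>rotation_centralizer z. h b))"
        using sum_over_involutions_eq_0[OF dim2, of b] B(1) b by auto
      also have "\<dots> = (\<Sum>z\<in>involutions. z b)"
        by (intro sum.cong refl) (simp add: triv)
      finally have "inner b (\<Sum>z\<in>involutions. z b) = 0" by simp
      then show ?thesis by (simp only: inner_sum_right)
    qed
    have trace: "(\<Sum>b\<in>B. inner b (z b)) = 1" if z: "z \<in> involutions" for z
    proof -
      have "root_of z \<in> span B" using root_span[OF z] B(6) by simp
      note parseval = sum_inner_orthonormal_basis[OF B(2,3) finB this]
      have "(\<Sum>b\<in>B. inner b (z b)) =
          (\<Sum>b\<in>B. inner b b) - 2 * (\<Sum>b\<in>B. (inner b (root_of z))\<^sup>2) / inner (root_of z) (root_of z)"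
        by (simp only: act[OF z] sum_subtractf sum_distrib_left sum_divide_distrib)
      also have "(\<Sum>b\<in>B. inner b b) = 3"
        using B(3) cardB by (simp add: dot_square_norm)
      finally show ?thesis using root_of(1)[OF z] by (simp add: parseval)
    qed
    have "0 = (\<Sum>b\<in>B. \<Sum>z\<in>involutions. inner b (z b))" by (simp add: zero)
    also have "\<dots> = (\<Sum>z\<in>involutions. \<Sum>b\<in>B. inner b (z b))" by (rule sum.swap)
    also have "\<dots> = real (card involutions)" by (simp add: trace)
    finally have "involutions = {}" using finite_involutions by simp
    then show False using z0 by blast
  next
    case False
    have nontriv: "rotation_centralizer z \<noteq> {id}" if "z \<in> involutions" for z
      using rotation_centralizer_trivial_uniform[OF that z0] False by blast
    \<comment> \<open>The quadratic form of the sum is evaluated at a root, where the term of its own reflection is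
      strictly negative.\<close>
    define x where "x = root_of ?z0"
    have x: "x \<in> span V" "x \<noteq> 0" unfolding x_def by (rule root_span[OF z0], rule root_of(1)[OF z0])
    define F where "F = (\<lambda>z. real (card (rotation_centralizer z)) * (inner x (root_of z))\<^sup>2 / inner (root_of z) (root_of z))"
    have "inner x (z (\<Sum>h\<in>rotation_centralizer z. h x)) = - F z" if z: "z \<in> involutions" for z
    proof -
      have zG: "z \<in> carrier G" using z by (simp add: involutions_def)
      have "z (root_of z) = - root_of z"
        using reflection_self[of "root_of z"] by (simp only: root_of(2)[OF z])
      then show ?thesis
        unfolding sum_rotation_centralizer[OF dim z nontriv[OF z] x(1)] linear_scale[OF linear_carrier[OF zG]]
        by (simp add: F_def power2_eq_square)
    qed
    then have "(\<Sum>z\<in>involutions. F z) = - inner x (\<Sum>z\<in>involutions. z (\<Sum>h\<in>rotation_centralizer z. h x))"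
      by (simp add: inner_sum_right sum_negf)
    also have "\<dots> = 0" by (simp only: sum_over_involutions_eq_0[OF dim2 x(1)] inner_zero_right minus_zero)
    finally have "(\<Sum>z\<in>involutions. F z) = 0" .
    moreover have "F z \<ge> 0" for z by (simp add: F_def)
    ultimately have "F ?z0 = 0"
      using sum_nonneg_eq_0_iff[OF finite_involutions, of F] z0 by blast
    moreover have "F ?z0 = real (card (rotation_centralizer ?z0)) * inner x x"
      using x(2) by (simp add: F_def x_def[symmetric] power2_eq_square)
    moreover have "card (rotation_centralizer ?z0) > 0"
      using id_in_rotation_centralizer finite_rotation_centralizer by (auto simp: card_gt_0_iff)
    ultimately show False using x(2) by simp
  qed
qed

end

section \<open>Planar reflection groups are dihedral\<close>

text \<open>The value \<open>e2 = 0\<close> stands for the case that all roots are parallel. Admitting it treats the group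
  of order two, even in a space of dimension one, together with the others.\<close>

locale planar_reflection_group = odd_reflection_group +
  fixes e1 e2 :: 'a
  assumes e1: "inner e1 e1 = 1" and e12: "inner e1 e2 = 0" and e2: "e2 = 0 \<or> inner e2 e2 = 1"
    and planar: "V \<subseteq> span {e1, e2}" and e1_root: "reflection e1 \<in> carrier G"
begin

definition is_rotation :: "('a \<Rightarrow> 'a) \<Rightarrow> real \<Rightarrow> real \<Rightarrow> bool" where
  "is_rotation g a b \<longleftrightarrow> g e1 = a *\<^sub>R e1 + b *\<^sub>R e2 \<and> g e2 = a *\<^sub>R e2 - b *\<^sub>R e1"

definition is_reflection :: "('a \<Rightarrow> 'a) \<Rightarrow> real \<Rightarrow> real \<Rightarrow> bool" where
  "is_reflection g a b \<longleftrightarrow> g e1 = a *\<^sub>R e1 + b *\<^sub>R e2 \<and> g e2 = b *\<^sub>R e1 - a *\<^sub>R e2"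

lemma reflection_is_reflection:
  assumes u: "u \<in> V"
  shows "\<exists>a b. is_reflection (reflection u) a b"
proof -
  \<comment> \<open>If \<open>e2 = 0\<close>, the coefficient \<open>q\<close> is arbitrary, and only \<open>q = 0\<close> gives the formulas below.\<close>
  have "\<exists>p q. u = p *\<^sub>R e1 + q *\<^sub>R e2 \<and> (e2 = 0 \<longrightarrow> q = 0)"
  proof -
    have "u \<in> span {e1, e2}" using u planar by blast
    then obtain p where "u - p *\<^sub>R e1 \<in> span {e2}" by (auto simp: span_insert)
    then obtain q where "u - p *\<^sub>R e1 = q *\<^sub>R e2" by (auto simp: span_singleton)
    then have pq: "u = p *\<^sub>R e1 + q *\<^sub>R e2" by (simp add: algebra_simps)
    show ?thesis
    proof (cases "e2 = 0")
      case True
      then show ?thesis using pq by (intro exI[of _ p] exI[of _ 0]) simp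
    qed (use pq in blast)
  qed
  then obtain p q where pq: "u = p *\<^sub>R e1 + q *\<^sub>R e2" "e2 = 0 \<Longrightarrow> q = 0" by blast
  have e22: "q * inner e2 e2 = q" using e2 pq(2) by auto
  have e21: "inner e2 e1 = 0" using e12 by (simp add: inner_commute)
  have i1: "inner e1 u = p" by (simp add: pq(1) inner_add_right e1 e12)
  have i2: "inner e2 u = q" by (simp add: pq(1) inner_add_right e21 e22)
  define N where "N = p * p + q * q"
  have uu: "inner u u = N"
  proof -
    have "inner u u = p * inner e1 u + q * inner e2 u"
      by (subst pq(1)) (simp add: inner_add_left)
    then show ?thesis by (simp only: i1 i2 N_def)
  qed
  have N: "N \<noteq> 0" using u nonzero uu by auto
  have r1: "reflection u e1 = e1 - (2 * p / N) *\<^sub>R (p *\<^sub>R e1 + q *\<^sub>R e2)"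
    by (simp only: reflection_def i1 uu) (simp only: pq(1))
  have r2: "reflection u e2 = e2 - (2 * q / N) *\<^sub>R (p *\<^sub>R e1 + q *\<^sub>R e2)"
    by (simp only: reflection_def i2 uu) (simp only: pq(1))
  define a b where "a = 1 - 2 * p * p / N" and "b = - (2 * p * q / N)"
  have a: "- a = 1 - 2 * q * q / N"
    using N by (simp add: a_def N_def field_simps)
  have "reflection u e1 = a *\<^sub>R e1 + b *\<^sub>R e2"
    by (simp add: r1 a_def b_def algebra_simps)
  moreover have "reflection u e2 = b *\<^sub>R e1 - a *\<^sub>R e2"
  proof -
    have "reflection u e2 = b *\<^sub>R e1 + (1 - 2 * q * q / N) *\<^sub>R e2"
      by (simp add: r2 b_def algebra_simps)
    then show ?thesis by (simp only: a[symmetric]) simp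
  qed
  ultimately show ?thesis by (auto simp: is_reflection_def)
qed

lemma rotation_or_reflection:
  "g \<in> carrier G \<Longrightarrow> (linear_det g = 1 \<longrightarrow> (\<exists>a b. is_rotation g a b)) \<and>
    (linear_det g = -1 \<longrightarrow> (\<exists>a b. is_reflection g a b))"
proof (erule carrier_induct)
  show "(linear_det id = 1 \<longrightarrow> (\<exists>a b. is_rotation id a b)) \<and>
    (linear_det (id :: 'a \<Rightarrow> 'a) = -1 \<longrightarrow> (\<exists>a b. is_reflection id a b))"
  proof -
    have "is_rotation id 1 0" by (simp add: is_rotation_def)
    then show ?thesis unfolding linear_det_id by auto
  qed
next
  fix v assume v: "v \<in> V"
  show "(linear_det (reflection v) = 1 \<longrightarrow> (\<exists>a b. is_rotation (reflection v) a b)) \<and>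
    (linear_det (reflection v) = -1 \<longrightarrow> (\<exists>a b. is_reflection (reflection v) a b))"
    using reflection_is_reflection[OF v] det_reflection[OF v] by auto
next
  fix f g assume fG: "f \<in> carrier G" and gG: "g \<in> carrier G"
  note lin = linear_add[OF linear_carrier[OF fG]] linear_diff[OF linear_carrier[OF fG]]
    linear_scale[OF linear_carrier[OF fG]]
  have 1: "is_rotation (f \<circ> g) (a * a' - b * b') (b * a' + a * b')"
    if "is_rotation f a b" "is_rotation g a' b'" for a b a' b'
    using that unfolding is_rotation_def o_apply
    by (simp only: lin) (simp add: algebra_simps)
  have 2: "is_reflection (f \<circ> g) (a * a' - b * b') (b * a' + a * b')"
    if "is_rotation f a b" "is_reflection g a' b'" for a b a' b'
    using that unfolding is_rotation_def is_reflection_def o_apply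
    by (simp only: lin) (simp add: algebra_simps)
  have 3: "is_reflection (f \<circ> g) (a * a' + b * b') (b * a' - a * b')"
    if "is_reflection f a b" "is_rotation g a' b'" for a b a' b'
    using that unfolding is_rotation_def is_reflection_def o_apply
    by (simp only: lin) (simp add: algebra_simps)
  have 4: "is_rotation (f \<circ> g) (a * a' + b * b') (b * a' - a * b')"
    if "is_reflection f a b" "is_reflection g a' b'" for a b a' b'
    using that unfolding is_rotation_def is_reflection_def o_apply
    by (simp only: lin) (simp add: algebra_simps)
  assume "(linear_det f = 1 \<longrightarrow> (\<exists>a b. is_rotation f a b)) \<and> (linear_det f = -1 \<longrightarrow> (\<exists>a b. is_reflection f a b))"
    "(linear_det g = 1 \<longrightarrow> (\<exists>a b. is_rotation g a b)) \<and> (linear_det g = -1 \<longrightarrow> (\<exists>a b. is_reflection g a b))"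
  then show "(linear_det (f \<circ> g) = 1 \<longrightarrow> (\<exists>a b. is_rotation (f \<circ> g) a b)) \<and>
    (linear_det (f \<circ> g) = -1 \<longrightarrow> (\<exists>a b. is_reflection (f \<circ> g) a b))"
    using det_cases[OF fG] det_cases[OF gG] 1 2 3 4
    unfolding det_comp[OF fG gG] by (elim disjE) (simp_all, blast+)
qed

definition rotations :: "('a \<Rightarrow> 'a) set" where
  "rotations = {g \<in> carrier G. linear_det g = 1}"

text \<open>The complex number \<open>a + i b\<close> of the rotation with matrix entries \<open>a\<close> and \<open>b\<close>.\<close>

definition rotation_number :: "('a \<Rightarrow> 'a) \<Rightarrow> complex" where
  "rotation_number g = Complex (inner (g e1) e1) (inner (g e1) e2)"

lemma rotation_number_eq:
  assumes g: "g \<in> carrier G" and rot: "is_rotation g a b"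
  shows "rotation_number g = Complex a b"
proof -
  have ge: "g e1 = a *\<^sub>R e1 + b *\<^sub>R e2" "g e2 = a *\<^sub>R e2 - b *\<^sub>R e1"
    using rot by (simp_all only: is_rotation_def)
  have e21: "inner e2 e1 = 0" using e12 by (simp add: inner_commute)
  have "b * inner e2 e2 = b"
    using e2
  proof
    assume "e2 = 0"
    then have "- b *\<^sub>R e1 = 0"
      using ge(2) linear_0[OF linear_carrier[OF g]] by simp
    then have "b = 0" using e1 by auto
    then show ?thesis by simp
  qed simp
  then show ?thesis
    by (simp add: rotation_number_def ge(1) inner_add_left e1 e12 e21)
qed

lemma is_rotation_rotation_number:
  assumes "g \<in> rotations"
  shows "is_rotation g (Re (rotation_number g)) (Im (rotation_number g))"
proof -
  have g: "g \<in> carrier G" "linear_det g = 1" using assms by (auto simp: rotations_def)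
  obtain a b where "is_rotation g a b" using rotation_or_reflection[OF g(1)] g(2) by blast
  with rotation_number_eq[OF g(1) this] show ?thesis by simp
qed

lemma rotations_comp: "f \<in> rotations \<Longrightarrow> g \<in> rotations \<Longrightarrow> f \<circ> g \<in> rotations"
  by (simp add: rotations_def comp_in det_comp)

lemma id_rotation: "id \<in> rotations"
  by (simp add: rotations_def id_in linear_det_id)

lemma rotations_pow: "g \<in> rotations \<Longrightarrow> g ^^ k \<in> rotations"
  by (induction k) (simp_all only: funpow.simps rotations_comp id_rotation)

lemma rotation_number_comp:
  assumes f: "f \<in> rotations" and g: "g \<in> rotations"
  shows "rotation_number (f \<circ> g) = rotation_number f * rotation_number g"
proof -
  define a b a' b' where ab: "a = Re (rotation_number f)" "b = Im (rotation_number f)"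
    "a' = Re (rotation_number g)" "b' = Im (rotation_number g)"
  have fG: "f \<in> carrier G" and gG: "g \<in> carrier G" using f g by (auto simp: rotations_def)
  note lin = linear_add[OF linear_carrier[OF fG]] linear_diff[OF linear_carrier[OF fG]]
    linear_scale[OF linear_carrier[OF fG]]
  have "is_rotation f a b" "is_rotation g a' b'"
    using is_rotation_rotation_number f g by (simp_all add: ab)
  then have "is_rotation (f \<circ> g) (a * a' - b * b') (b * a' + a * b')"
    unfolding is_rotation_def o_apply by (simp only: lin) (simp add: algebra_simps)
  then have "rotation_number (f \<circ> g) = Complex (a * a' - b * b') (b * a' + a * b')"
    by (rule rotation_number_eq[OF comp_in[OF fG gG]])
  then show ?thesis by (simp add: ab complex_eq_iff)
qed

lemma rotation_number_id: "rotation_number id = 1"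
  by (simp add: rotation_number_def e1 e12 complex_eq_iff)

lemma rotation_number_pow: "g \<in> rotations \<Longrightarrow> rotation_number (g ^^ k) = rotation_number g ^ k"
  by (induction k) (simp_all only: funpow.simps power.simps rotation_number_id rotation_number_comp rotations_pow)

text \<open>A rotation is determined on the plane of the roots by its rotation number, and it is the
  identity on the orthogonal complement.\<close>

lemma inj_rotation_number: "inj_on rotation_number rotations"
proof (rule inj_onI)
  fix f g assume f: "f \<in> rotations" and g: "g \<in> rotations" and eq: "rotation_number f = rotation_number g"
  have fG: "f \<in> carrier G" and gG: "g \<in> carrier G" using f g by (auto simp: rotations_def)
  note lf = linear_carrier[OF fG] and lg = linear_carrier[OF gG]
  have "f e1 = g e1" "f e2 = g e2"
    using is_rotation_rotation_number[OF f] is_rotation_rotation_number[OF g]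
    by (simp_all only: is_rotation_def eq)
  then have "{e1, e2} \<subseteq> {x. f x = g x}" by simp
  moreover have "Real_Vector_Spaces.subspace {x. f x = g x}"
    by (simp add: Real_Vector_Spaces.subspace_def linear_0[OF lf] linear_0[OF lg]
        linear_add[OF lf] linear_add[OF lg] linear_scale[OF lf] linear_scale[OF lg])
  ultimately have "span {e1, e2} \<subseteq> {x. f x = g x}" by (rule span_minimal)
  with planar have "V \<subseteq> {x. f x = g x}" by (rule subset_trans)
  then have spanV: "span V \<subseteq> {x. f x = g x}"
    using \<open>Real_Vector_Spaces.subspace {x. f x = g x}\<close> by (rule span_minimal)
  show "f = g"
  proof
    fix x
    obtain a b where ab: "a \<in> span V" "\<And>w. w \<in> span V \<Longrightarrow> Linear_Algebra.orthogonal b w" "x = a + b"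
    proof (rule orthogonal_subspace_decomp_exists[of V x])
      fix a b assume "a \<in> span V" "\<And>w. w \<in> span V \<Longrightarrow> Linear_Algebra.orthogonal b w" "x = a + b"
      then show thesis by (rule that)
    qed
    have perp: "inner b w = 0" if "w \<in> V" for w
      using ab(2)[OF span_base[OF that]] by (simp only: Linear_Algebra.orthogonal_def)
    have "f b = b" "g b = b" using carrier_fixes[OF fG perp] carrier_fixes[OF gG perp] by blast+
    moreover have "f a = g a" using subsetD[OF spanV ab(1)] by (rule CollectD)
    ultimately show "f x = g x" by (simp only: ab(3) linear_add[OF lf] linear_add[OF lg])
  qed
qed

lemma finite_rotations: "finite rotations"
  using finite_carrier by (simp add: rotations_def)

lemma rotation_number_nonzero:
  assumes g: "g \<in> rotations"
  shows "rotation_number g \<noteq> 0"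
proof -
  obtain m where m: "odd m" "g ^^ m = id" using odd_rotation[of g] g by (auto simp: rotations_def)
  then have "rotation_number g ^ m = 1" using rotation_number_pow[OF g, of m] rotation_number_id by simp
  then show ?thesis using m(1) by (cases m) auto
qed

lemma rotations_inverse:
  assumes g: "g \<in> rotations"
  obtains h where "h \<in> rotations" "h \<circ> g = id" "g \<circ> h = id"
proof -
  have gG: "g \<in> carrier G" "linear_det g = 1" using g by (auto simp: rotations_def)
  obtain h where h: "h \<in> carrier G" "h \<circ> g = id" "g \<circ> h = id" using inverse_carrier[OF gG(1)] by metis
  have "linear_det h = 1" using det_comp[OF h(1) gG(1)] by (simp add: h(2) linear_det_id gG(2))
  then show thesis using that h by (simp add: rotations_def)
qed

text \<open>Comparing the product of all rotation numbers with that of their multiples by one of them shows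
  that they are \<open>n\<close>-th roots of unity, where \<open>n\<close> is their number. So they are all of these.\<close>

lemma rotation_number_image:
  "rotation_number ` rotations = {z. z ^ card rotations = 1}"
proof -
  let ?n = "card rotations"
  have n: "?n > 0" using id_rotation finite_rotations by (auto simp: card_gt_0_iff)
  have "rotation_number g ^ ?n = 1" if g: "g \<in> rotations" for g
  proof -
    obtain h where h: "h \<in> rotations" "h \<circ> g = id" "g \<circ> h = id" using rotations_inverse[OF g] .
    have "(\<Prod>f\<in>rotations. rotation_number f) = (\<Prod>f\<in>rotations. rotation_number (g \<circ> f))"
      by (rule prod.reindex_bij_witness[where i = "\<lambda>f. g \<circ> f" and j = "\<lambda>f. h \<circ> f"])
        (simp_all only: comp_assoc[symmetric] h id_comp rotations_comp[OF g] rotations_comp[OF h(1)])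
    also have "\<dots> = (\<Prod>f\<in>rotations. rotation_number g * rotation_number f)"
      by (intro prod.cong refl rotation_number_comp g)
    also have "\<dots> = rotation_number g ^ ?n * (\<Prod>f\<in>rotations. rotation_number f)"
      by (simp add: prod.distrib)
    finally show ?thesis
      using rotation_number_nonzero finite_rotations by simp
  qed
  then have "rotation_number ` rotations \<subseteq> {z. z ^ ?n = 1}" by auto
  moreover have "card (rotation_number ` rotations) = card {z::complex. z ^ ?n = 1}"
    using card_image[OF inj_rotation_number] card_roots_unity_eq[OF n] by simp
  ultimately show ?thesis
    using n by (intro card_subset_eq finite_roots_unity) auto
qed

text \<open>Otherwise \<open>-1\<close> would be the rotation number of some rotation, whose order would be even.\<close>

lemma odd_card_rotations: "odd (card rotations)"
proof
  assume even: "even (card rotations)"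
  then have "(-1) ^ card rotations = (1 :: complex)" by simp
  then have "-1 \<in> rotation_number ` rotations" by (simp add: rotation_number_image)
  then obtain g where g: "g \<in> rotations" "rotation_number g = -1" by auto
  obtain m where m: "odd m" "g ^^ m = id" using odd_rotation[of g] g by (auto simp: rotations_def)
  have "(-1 :: complex) ^ m = 1" using rotation_number_pow[OF g(1), of m] m(2) g(2) rotation_number_id by simp
  then show False using m(1) by simp
qed

text \<open>Conjugation by the reflection turns the rotation number into its complex conjugate, which is its
  inverse on the unit circle.\<close>

lemma reflection_inverts:
  assumes g: "g \<in> rotations"
  shows "g \<circ> (reflection e1 \<circ> (g \<circ> reflection e1)) = id"
proof -
  let ?s = "reflection e1"
  have gG: "g \<in> carrier G" "linear_det g = 1" using g by (auto simp: rotations_def)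
  have "e1 \<noteq> 0" using e1 by auto
  then have det: "linear_det ?s = -1" by (rule linear_det_reflection)
  have conj: "?s \<circ> (g \<circ> ?s) \<in> rotations"
    unfolding rotations_def mem_Collect_eq
    by (simp only: comp_in[OF e1_root comp_in[OF gG(1) e1_root]]
        det_comp[OF e1_root comp_in[OF gG(1) e1_root]] det_comp[OF gG(1) e1_root] det gG(2)) simp
  define a b where ab: "a = Re (rotation_number g)" "b = Im (rotation_number g)"
  have rot: "is_rotation g a b" using is_rotation_rotation_number[OF g] by (simp add: ab)
  have s: "?s e1 = - e1" "?s e2 = e2"
    using e12 by (simp_all add: reflection_self) (simp add: reflection_def inner_commute[of e2])
  have "?s (g (?s e1)) = a *\<^sub>R e1 - b *\<^sub>R e2"
    using rot s linear_neg[OF linear_carrier[OF gG(1)], of e1]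
    by (simp add: is_rotation_def linear_diff[OF linear_reflection] linear_scale[OF linear_reflection]
        linear_neg[OF linear_reflection])
  moreover have "?s (g (?s e2)) = a *\<^sub>R e2 + b *\<^sub>R e1"
    using rot s
    by (simp add: is_rotation_def linear_diff[OF linear_reflection] linear_scale[OF linear_reflection])
  ultimately have "is_rotation (?s \<circ> (g \<circ> ?s)) a (- b)"
    by (simp add: is_rotation_def)
  then have "rotation_number (?s \<circ> (g \<circ> ?s)) = cnj (rotation_number g)"
    using conj by (subst rotation_number_eq) (auto simp: rotations_def ab complex_eq_iff)
  then have "rotation_number (g \<circ> (?s \<circ> (g \<circ> ?s))) = rotation_number g * cnj (rotation_number g)"
    using rotation_number_comp[OF g conj] by simp
  also have "\<dots> = 1"
  proof -
    have "rotation_number g ^ card rotations = 1" using rotation_number_image g by blast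
    then have "norm (rotation_number g) ^ card rotations = 1" by (metis norm_one norm_power)
    then have "norm (rotation_number g) = 1"
      using power_eq_imp_eq_base[of "norm (rotation_number g)" "card rotations" 1]
        odd_pos[OF odd_card_rotations] by simp
    then show ?thesis by (simp add: complex_norm_square[symmetric])
  qed
  finally show ?thesis
    using inj_onD[OF inj_rotation_number _ rotations_comp[OF g conj] id_rotation] rotation_number_id by simp
qed

end

context planar_reflection_group
begin

text \<open>The rotation \<open>r\<close> with rotation number \<open>exp (2 \<pi> i / n)\<close> generates the rotations, and \<open>r\<close> together with
  the reflection in \<open>e1\<close> generates the group. The isomorphism takes \<open>r\<^sup>a s\<close> to \<open>(a, True)\<close> and
  \<open>r\<^sup>a\<close> to \<open>(a, False)\<close>.\<close>

theorem iso_dihedral: "G \<cong> dihedral_group (card rotations)"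
proof -
  define n where "n = card rotations"
  let ?s = "reflection e1"
  have n: "n > 0" unfolding n_def by (rule odd_pos[OF odd_card_rotations])
  define \<omega> where "\<omega> = (\<lambda>k. cis (2 * pi * real k / real n))"
  have roots: "bij_betw \<omega> {..<n} {z. z ^ n = 1}"
    unfolding \<omega>_def by (rule bij_betw_roots_unity[OF n])
  have \<omega>_pow: "\<omega> k = \<omega> 1 ^ k" for k
    by (simp add: \<omega>_def DeMoivre mult_ac)
  have "\<omega> 1 ^ n = 1" using n by (simp add: \<omega>_def DeMoivre)
  then have "\<omega> 1 \<in> rotation_number ` rotations" by (simp add: rotation_number_image n_def)
  then obtain r where r: "r \<in> rotations" "rotation_number r = \<omega> 1" by auto
  have r_pow: "r ^^ k \<in> rotations" "rotation_number (r ^^ k) = \<omega> k" for k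
    by (rule rotations_pow[OF r(1)]) (simp only: rotation_number_pow[OF r(1)] r(2) \<omega>_pow[of k])
  have "r ^^ n = id"
  proof (rule inj_onD[OF inj_rotation_number _ r_pow(1) id_rotation])
    show "rotation_number (r ^^ n) = rotation_number id"
      using r_pow(2)[of n] n by (simp add: \<omega>_def rotation_number_id)
  qed
  then have r_mod: "r ^^ (k mod n) = r ^^ k" for k
    using funpow_mod_eq[of n r _ k] by (simp add: fun_eq_iff)
  have r_eqD: "k = l" if "r ^^ k = r ^^ l" "k < n" "l < n" for k l
    using that r_pow(2)[of k] r_pow(2)[of l] roots by (auto simp: bij_betw_def inj_on_def)
  have rot_pow: "\<exists>k<n. g = r ^^ k" if g: "g \<in> rotations" for g
  proof -
    have "rotation_number g ^ n = 1" using rotation_number_image g unfolding n_def by blast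
    then obtain k where k: "k < n" "rotation_number g = \<omega> k"
      using roots by (auto simp: bij_betw_def)
    have "g = r ^^ k"
      by (rule inj_onD[OF inj_rotation_number _ g r_pow(1)]) (simp only: k(2) r_pow(2))
    with k(1) show ?thesis by blast
  qed
  have ss: "?s \<circ> ?s = id" by (rule reflection_comp_self)
  have "e1 \<noteq> 0" using e1 by auto
  then have det_s: "linear_det ?s = -1" by (rule linear_det_reflection)
  have r_in: "r ^^ k \<in> carrier G" and det_r: "linear_det (r ^^ k) = 1" for k
    using r_pow(1)[of k] by (simp_all add: rotations_def)
  have swap: "r ^^ k \<circ> (?s \<circ> r ^^ k) = ?s" for k
  proof -
    have "r ^^ k \<circ> (?s \<circ> (r ^^ k \<circ> ?s)) \<circ> ?s = ?s"
      by (simp only: reflection_inverts[OF r_pow(1)] id_comp)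
    then show ?thesis by (simp only: comp_assoc ss comp_id)
  qed
  define \<psi> where "\<psi> = (\<lambda>(a, t). r ^^ nat a \<circ> (if t then ?s else id))"
  have det_\<psi>: "linear_det (\<psi> (a, t)) = (if t then -1 else 1)" for a t
    using det_comp[OF r_in e1_root] det_r det_s by (simp add: \<psi>_def)
  have closed: "\<psi> p \<in> carrier G" for p
    using comp_in[OF r_in e1_root] r_in by (cases p) (simp add: \<psi>_def)
  have nat_mod: "r ^^ nat ((a + b) mod int n) = r ^^ nat a \<circ> r ^^ nat b" if "0 \<le> a" "0 \<le> b" for a b
  proof -
    have "nat ((a + b) mod int n) = (nat a + nat b) mod n"
      using that by (simp add: nat_mod_distrib nat_add_distrib)
    then show ?thesis by (simp only: r_mod funpow_add)
  qed
  have "\<psi> \<in> hom (dihedral_group n) G"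
  proof (rule homI)
    fix p q assume p: "p \<in> carrier (dihedral_group n)" and q: "q \<in> carrier (dihedral_group n)"
    obtain a t b u where pq: "p = (a, t)" "q = (b, u)" by force
    have ab: "0 \<le> a" "a < int n" "0 \<le> b" "b < int n" using p q by (auto simp: dihedral_group_def pq)
    show "\<psi> (p \<otimes>\<^bsub>dihedral_group n\<^esub> q) = \<psi> p \<otimes>\<^bsub>G\<^esub> \<psi> q"
    proof (cases t)
      case False
      then show ?thesis
        using nat_mod[OF ab(1,3)] by (simp add: pq dihedral_group_def \<psi>_def mult_G comp_assoc)
    next
      case True
      define m where "m = (a - b) mod int n"
      have "0 \<le> m" using n by (simp add: m_def)
      \<comment> \<open>Write \<open>r\<^sup>a = r\<^sup>m r\<^sup>b\<close> and use that \<open>s\<close> inverts \<open>r\<^sup>b\<close>.\<close>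
      have "(m + b) mod int n = a" using ab by (simp add: m_def mod_simps)
      then have "r ^^ nat a = r ^^ nat m \<circ> r ^^ nat b" using nat_mod[OF \<open>0 \<le> m\<close> ab(3)] by simp
      then have "r ^^ nat a \<circ> ?s \<circ> r ^^ nat b = r ^^ nat m \<circ> (r ^^ nat b \<circ> (?s \<circ> r ^^ nat b))"
        by (simp only: comp_assoc)
      then have key: "r ^^ nat a \<circ> ?s \<circ> r ^^ nat b = r ^^ nat m \<circ> ?s" by (simp only: swap)
      have "\<psi> p \<otimes>\<^bsub>G\<^esub> \<psi> q = (r ^^ nat a \<circ> ?s \<circ> r ^^ nat b) \<circ> (if u then ?s else id)"
        using True by (simp add: pq \<psi>_def mult_G comp_assoc)
      also have "\<dots> = r ^^ nat m \<circ> (if u then id else ?s)"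
        unfolding key by (cases u) (simp_all only: comp_assoc ss if_True if_False comp_id)
      also have "\<dots> = \<psi> (p \<otimes>\<^bsub>dihedral_group n\<^esub> q)"
        using True by (simp add: pq dihedral_group_def \<psi>_def m_def)
      finally show ?thesis by simp
    qed
  qed (rule closed)
  moreover have "bij_betw \<psi> (carrier (dihedral_group n)) (carrier G)"
  proof (rule bij_betw_imageI)
    show "inj_on \<psi> (carrier (dihedral_group n))"
    proof (rule inj_onI, clarify)
      fix a t b u
      assume ab: "(a, t) \<in> carrier (dihedral_group n)" "(b, u) \<in> carrier (dihedral_group n)"
        and eq: "\<psi> (a, t) = \<psi> (b, u)"
      have "t = u" using det_\<psi>[of a t] det_\<psi>[of b u] eq by (auto split: if_splits)
      then have "\<psi> (a, t) \<circ> (if t then ?s else id) = \<psi> (b, t) \<circ> (if t then ?s else id)"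
        using eq by simp
      then have "r ^^ nat a = r ^^ nat b"
        by (cases t) (simp_all add: \<psi>_def comp_assoc ss)
      then have "nat a = nat b" using ab by (intro r_eqD) (auto simp: dihedral_group_def)
      then show "a = b \<and> t = u" using ab \<open>t = u\<close> by (auto simp: dihedral_group_def)
    qed
    show "\<psi> ` carrier (dihedral_group n) = carrier G"
    proof (intro equalityI subsetI)
      fix g assume g: "g \<in> carrier G"
      from det_cases[OF g] show "g \<in> \<psi> ` carrier (dihedral_group n)"
      proof
        assume "linear_det g = 1"
        then obtain k where "k < n" "g = r ^^ k" using rot_pow g by (auto simp: rotations_def)
        then show ?thesis
          by (intro image_eqI[of _ _ "(int k, False)"]) (auto simp: \<psi>_def dihedral_group_def)
      next
        assume "linear_det g = -1"
        then have "linear_det (g \<circ> ?s) = 1" by (simp only: det_comp[OF g e1_root] det_s)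
        then obtain k where k: "k < n" "g \<circ> ?s = r ^^ k"
          using rot_pow comp_in[OF g e1_root] by (auto simp: rotations_def)
        have "g \<circ> (?s \<circ> ?s) = r ^^ k \<circ> ?s" by (simp only: comp_assoc[symmetric] k(2))
        then have "g = r ^^ k \<circ> ?s" by (simp only: ss comp_id)
        with k(1) show ?thesis
          by (intro image_eqI[of _ _ "(int k, True)"]) (auto simp: \<psi>_def dihedral_group_def)
      qed
    qed (use closed in auto)
  qed
  ultimately have hom: "\<psi> \<in> hom (dihedral_group n) G"
    and bij: "bij_betw \<psi> (carrier (dihedral_group n)) (carrier G)" .
  define \<phi> where "\<phi> = inv_into (carrier (dihedral_group n)) \<psi>"
  have bij': "bij_betw \<phi> (carrier G) (carrier (dihedral_group n))"
    unfolding \<phi>_def by (rule bij_betw_inv_into[OF bij])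
  have \<phi>_in: "\<phi> g \<in> carrier (dihedral_group n)" and \<psi>\<phi>: "\<psi> (\<phi> g) = g" if "g \<in> carrier G" for g
    using bij_betwE[OF bij'] bij_betw_inv_into_right[OF bij] that by (auto simp: \<phi>_def)
  have "\<phi> \<in> hom G (dihedral_group n)"
  proof (rule homI[OF \<phi>_in])
    fix g h assume g: "g \<in> carrier G" and h: "h \<in> carrier G"
    let ?p = "\<phi> g \<otimes>\<^bsub>dihedral_group n\<^esub> \<phi> h"
    have "?p \<in> carrier (dihedral_group n)"
      using n by (auto simp: dihedral_group_def split: prod.splits)
    then have "\<phi> (\<psi> ?p) = ?p"
      unfolding \<phi>_def by (rule bij_betw_inv_into_left[OF bij])
    moreover have "\<psi> ?p = g \<otimes>\<^bsub>G\<^esub> h"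
      using hom_mult[OF hom \<phi>_in[OF g] \<phi>_in[OF h]] by (simp only: \<psi>\<phi>[OF g] \<psi>\<phi>[OF h])
    ultimately show "\<phi> (g \<otimes>\<^bsub>G\<^esub> h) = ?p" by simp
  qed
  with bij' show ?thesis by (auto simp: is_iso_def iso_def n_def)
qed

end

context odd_reflection_group
begin

text \<open>The reflections in three independent roots would generate a group of the same kind whose roots
  span a space of dimension three.\<close>

lemma roots_coplanar:
  assumes "v \<in> V" "w \<in> V" "w \<notin> span {v}" "u \<in> V"
  shows "u \<in> span {v, w}"
proof (rule ccontr)
  assume u: "u \<notin> span {v, w}"
  define V0 where "V0 = {u, v, w}"
  define G0 where "G0 = subgroup_generated orthogonal_group (reflection ` V0)"
  have V0: "V0 \<subseteq> V" using assms by (simp add: V0_def)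
  have "v \<noteq> 0" using assms nonzero by auto
  then have "independent {v, w}"
    using independent_insertI[of w "{v}"] assms(3) by (simp add: insert_commute)
  then have ind: "independent V0"
    unfolding V0_def by (rule independent_insertI[OF u])
  have "u \<noteq> v" "u \<noteq> w" "v \<noteq> w"
    using u span_base[of u "{v, w}"] assms(3) span_base[of w "{v}"] by auto
  then have dim: "dim V0 = 3"
    using dim_eq_card_independent[OF ind] by (simp add: V0_def)
  have sub: "carrier G0 \<subseteq> carrier G"
    unfolding G0_def G_def carrier_subgroup_generated
    by (rule group.mono_generate[OF group_orthogonal_group]) (use V0 in blast)
  have "odd_reflection_group V0 G0"
  proof
    show "G0 = subgroup_generated orthogonal_group (reflection ` V0)" by (rule G0_def)
    show "0 \<notin> V0" using nonzero V0 by blast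
    show "finite (carrier G0)" using sub finite_carrier by (rule finite_subset)
    show "V0 \<noteq> {}" by (simp add: V0_def)
    show "\<exists>m. odd m \<and> g ^^ m = id" if "g \<in> carrier G0" "linear_det g = 1" for g
      using odd_rotation[of g] that sub by blast
  qed
  then show False using odd_reflection_group.dim_roots_neq_3 dim by blast
qed

text \<open>Gram-Schmidt orthogonalisation of a root and, if there is one, a root that is not parallel to it.\<close>

lemma planar_frame: "\<exists>e1 e2. planar_reflection_group V G e1 e2"
proof -
  obtain v where v: "v \<in> V" using nonempty by auto
  then have v0: "v \<noteq> 0" using nonzero by auto
  define e1 where "e1 = (1 / norm v) *\<^sub>R v"
  have n1: "inner e1 e1 = 1" using v0 by (simp add: e1_def dot_square_norm power2_eq_square)
  have r1: "reflection e1 \<in> carrier G"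
    using reflection_in[OF v] v0 by (simp add: e1_def reflection_scaleR)
  have v_in: "v \<in> span {e1, e2}" for e2
  proof -
    have "norm v *\<^sub>R e1 \<in> span {e1, e2}" by (rule span_scale) (rule span_base, simp)
    then show ?thesis using v0 by (simp add: e1_def)
  qed
  show ?thesis
  proof (cases "V \<subseteq> span {v}")
    case True
    have "span {v} \<subseteq> span {e1, 0}" using v_in[of 0] by (intro span_minimal) auto
    with True have "V \<subseteq> span {e1, 0}" by (rule subset_trans)
    then have "planar_reflection_group V G e1 0"
      using n1 r1 by unfold_locales auto
    then show ?thesis by blast
  next
    case False
    then obtain w where w: "w \<in> V" "w \<notin> span {v}" by auto
    define c where "c = inner w e1"
    define w' where "w' = w - c *\<^sub>R e1"
    have e1_in: "e1 \<in> span {v}"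
      unfolding e1_def by (rule span_scale) (rule span_base, simp)
    have w'0: "w' \<noteq> 0"
    proof
      assume "w' = 0"
      then have "w = c *\<^sub>R e1" by (simp only: w'_def right_minus_eq)
      with e1_in have "w \<in> span {v}" by (simp add: span_scale)
      with w(2) show False ..
    qed
    define e2 where "e2 = (1 / norm w') *\<^sub>R w'"
    have n2: "inner e2 e2 = 1" using w'0 by (simp add: e2_def dot_square_norm power2_eq_square)
    have "inner e1 w' = 0" by (simp add: w'_def inner_diff_right n1) (simp add: c_def inner_commute)
    then have n12: "inner e1 e2 = 0" by (simp add: e2_def)
    have "norm w' *\<^sub>R e2 = w'" using w'0 by (simp add: e2_def)
    then have "w = c *\<^sub>R e1 + norm w' *\<^sub>R e2" by (simp add: w'_def)
    moreover have "c *\<^sub>R e1 \<in> span {e1, e2}" "norm w' *\<^sub>R e2 \<in> span {e1, e2}"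
      by (rule span_scale, rule span_base, simp)+
    ultimately have "w \<in> span {e1, e2}" using span_add by (simp only:)
    then have "span {v, w} \<subseteq> span {e1, e2}" using v_in[of e2] by (intro span_minimal) auto
    then have "V \<subseteq> span {e1, e2}" using roots_coplanar[OF v w] by blast
    then have "planar_reflection_group V G e1 e2"
      using n1 n12 n2 r1 by unfold_locales auto
    then show ?thesis by blast
  qed
qed

end

section \<open>Nonprincipal 2-constant characters of reflection groups\<close>

theorem theorem1p3:
  fixes G :: "('a::euclidean_space \<Rightarrow> 'a) monoid"
  assumes "finite_reflection_group G"
    and "carrier G \<noteq> {\<one>\<^bsub>G\<^esub>}"
  shows "(Upsilon 2 G \<noteq> {principal_character G} \<longleftrightarrow> (\<exists>n. odd n \<and> G \<cong> dihedral_group n)) \<and>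
    ((\<exists>n. odd n \<and> G \<cong> dihedral_group n) \<longrightarrow>
      Upsilon 2 G = linear_characters G \<and> card (linear_characters G) = 2)"
proof -
  obtain V where V: "0 \<notin> V" "G = subgroup_generated orthogonal_group (reflection ` V)"
    and fin: "finite (carrier G)"
    using assms(1) by (auto simp: finite_reflection_group_def)
  have "V \<noteq> {}"
  proof
    assume "V = {}"
    then have "carrier G = {\<one>\<^bsub>G\<^esub>}"
      using group.generate_empty[OF group_orthogonal_group]
      by (simp add: V(2) carrier_subgroup_generated)
    with assms(2) show False ..
  qed
  interpret reflection_group V G
    by unfold_locales (fact V fin \<open>V \<noteq> {}\<close>)+
  have dihedral: "\<exists>n. odd n \<and> G \<cong> dihedral_group n" if "Upsilon 2 G \<noteq> {principal_character G}"
  proof -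
    interpret sign: sign_character G "\<lambda>g. complex_of_real (linear_det g)"
      by (rule sign_character)
    interpret odd_reflection_group V G
    proof
      fix g assume g: "g \<in> carrier G" "linear_det g = 1"
      then have "odd (group.ord G g)"
        using sign.Upsilon_nonprincipal_imp_odd[OF that, of g] by simp
      with g(1) show "\<exists>m. odd m \<and> g ^^ m = id"
        using ord_odd_imp_funpow reflection_group_axioms by blast
    qed
    obtain e1 e2 where "planar_reflection_group V G e1 e2" using planar_frame by blast
    then interpret planar_reflection_group V G e1 e2 .
    show ?thesis using odd_card_rotations iso_dihedral by blast
  qed
  have pair: "Upsilon 2 G = linear_characters G \<and> card (linear_characters G) = 2"
    if "\<exists>n. odd n \<and> G \<cong> dihedral_group n"
    using that odd_dihedral_Upsilon[OF group_G] by blast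
  show ?thesis
  proof (intro conjI iffI impI)
    show "Upsilon 2 G \<noteq> {principal_character G}" if "\<exists>n. odd n \<and> G \<cong> dihedral_group n"
    proof
      assume "Upsilon 2 G = {principal_character G}"
      with pair[OF that] have "card {principal_character G} = 2" by simp
      then show False by simp
    qed
  qed (use dihedral pair in blast)+
qed

end
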